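(* When restricted to complete metrizable linear abelian groups (with continuous homomorphisms as morphisms), the functor $V\mapsto V_\bullet$ to $\mathbb M$-modules is fully faithful and preserves quotients (that is, if $W$ is a closed subgroup of a complete metrizable linear abelian group $V$, then $V_\bullet\to(V/W)_\bullet$ identifies $(V/W)_\bullet$ with $V_\bullet/W_\bullet$).
   Context: $\mathbb M$ is the ring of column-finite matrices $[c_{kn}]_{k,n\in\mathbb N}$ with integer coefficients (for each $n$, $c_{kn}=0$ for all but finitely many $k$); "module" means left module. A linear abelian group is a topological abelian group in which open subgroups form a basis of neighborhoods of $0$; it is complete (Hausdorff) if the canonical map $V\to\varprojlim_{V'}V/V'$ ($V'$ running through the open subgroups, each $V/V'$ discrete) is an isomorphism. For a complete linear abelian group $V$, $V_\bullet$ is the abelian group of sequences $(s_n)_{n\in\mathbb N}$ in $V$ with $s_n\to 0$ (seen as column vectors), with $\mathbb M$ acting by $[c_{kn}]\cdot(s_n)_n=(\sum_n c_{kn}s_n)_k$ (the sums converge). *)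

theory Defs
  imports
    "HOL-Analysis.Abstract_Metric_Spaces"
    "HOL-Analysis.Function_Topology"
    "HOL-Algebra.AbelCoset"
    "HOL-Algebra.Module"
begin

section \<open>Topological abelian groups\<close>

text \<open>Abelian groups \<open>V\<close> are written multiplicatively, so that \<open>comm_group\<close>, \<open>hom\<close>, cosets and
  so on can be used as they stand: the zero of \<open>V\<close> is \<open>\<one>\<close>, and the multiple of \<open>x\<close> by
  an integer \<open>c\<close> is \<open>x [^] c\<close>.\<close>

record 'a topgroup = "'a monoid" +
  topol :: "'a topology"

definition topological_abelian_group :: "'a topgroup \<Rightarrow> bool" where
  "topological_abelian_group V \<longleftrightarrow>
     comm_group V \<and> topspace (topol V) = carrier V \<and>
     continuous_map (prod_topology (topol V) (topol V)) (topol V) (\<lambda>(x, y). x \<otimes>\<^bsub>V\<^esub> y) \<and>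
     continuous_map (topol V) (topol V) (\<lambda>x. inv\<^bsub>V\<^esub> x)"

definition open_subgroups :: "'a topgroup \<Rightarrow> 'a set set" where
  "open_subgroups V = {U. subgroup U V \<and> openin (topol V) U}"

definition linear_abelian_group :: "'a topgroup \<Rightarrow> bool" where
  "linear_abelian_group V \<longleftrightarrow>
     topological_abelian_group V \<and>
     (\<forall>N. openin (topol V) N \<and> \<one>\<^bsub>V\<^esub> \<in> N \<longrightarrow> (\<exists>U\<in>open_subgroups V. U \<subseteq> N))"

definition topgroup_iso :: "'a topgroup \<Rightarrow> 'b topgroup \<Rightarrow> ('a \<Rightarrow> 'b) set" where
  "topgroup_iso V V' = {f \<in> iso V V'. homeomorphic_map (topol V) (topol V') f}"

text \<open>The limit of the discrete groups \<open>V/U\<close>, for \<open>U\<close> an open subgroup. For \<open>U \<subseteq> U'\<close>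
  the transition map \<open>V/U \<rightarrow> V/U'\<close> sends a coset \<open>C\<close> to the product set of \<open>U'\<close> and \<open>C\<close>.\<close>

definition completion_carrier :: "'a topgroup \<Rightarrow> ('a set \<Rightarrow> 'a set) set" where
  "completion_carrier V =
     {x \<in> (\<Pi>\<^sub>E U\<in>open_subgroups V. rcosets\<^bsub>V\<^esub> U).
        \<forall>U\<in>open_subgroups V. \<forall>U'\<in>open_subgroups V. U \<subseteq> U' \<longrightarrow> U' <#>\<^bsub>V\<^esub> x U = x U'}"

definition completion :: "'a topgroup \<Rightarrow> ('a set \<Rightarrow> 'a set) topgroup" where
  "completion V =
     \<lparr>carrier = completion_carrier V,
      mult = (\<lambda>x y. \<lambda>U\<in>open_subgroups V. x U <#>\<^bsub>V\<^esub> y U),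
      one = (\<lambda>U\<in>open_subgroups V. U),
      topol = subtopology
        (product_topology (\<lambda>U. discrete_topology (rcosets\<^bsub>V\<^esub> U)) (open_subgroups V))
        (completion_carrier V)\<rparr>"

definition complete_linear_abelian_group :: "'a topgroup \<Rightarrow> bool" where
  "complete_linear_abelian_group V \<longleftrightarrow>
     linear_abelian_group V \<and>
     (\<lambda>v. \<lambda>U\<in>open_subgroups V. U #>\<^bsub>V\<^esub> v) \<in> topgroup_iso V (completion V)"

definition complete_metrizable :: "'a topgroup \<Rightarrow> bool" where
  "complete_metrizable V \<longleftrightarrow> complete_linear_abelian_group V \<and> metrizable_space (topol V)"

text \<open>Maps between carriers are taken extensional (\<open>undefined\<close> outside the carrier), so that
  equality of morphisms is equality of HOL functions.\<close>

definition cont_hom :: "'a topgroup \<Rightarrow> 'b topgroup \<Rightarrow> ('a \<Rightarrow> 'b) set" where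
  "cont_hom V V' =
     {f \<in> hom V V' \<inter> extensional (carrier V). continuous_map (topol V) (topol V') f}"

definition subspace_group :: "'a topgroup \<Rightarrow> 'a set \<Rightarrow> 'a topgroup" where
  "subspace_group V W = V\<lparr>carrier := W, topol := subtopology (topol V) W\<rparr>"

definition quotient_topology :: "'a topology \<Rightarrow> ('a \<Rightarrow> 'b) \<Rightarrow> 'b topology" where
  "quotient_topology X q =
     topology (\<lambda>U. U \<subseteq> q ` topspace X \<and> openin X {x \<in> topspace X. q x \<in> U})"

lemma openin_quotient_topology:
  "openin (quotient_topology X q) U \<longleftrightarrow>
     U \<subseteq> q ` topspace X \<and> openin X {x \<in> topspace X. q x \<in> U}"
proof -
  have "istopology (\<lambda>U. U \<subseteq> q ` topspace X \<and> openin X {x \<in> topspace X. q x \<in> U})"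
    unfolding istopology_def
  proof (intro conjI allI impI)
    fix S T
    assume "S \<subseteq> q ` topspace X \<and> openin X {x \<in> topspace X. q x \<in> S}"
      and "T \<subseteq> q ` topspace X \<and> openin X {x \<in> topspace X. q x \<in> T}"
    moreover have "{x \<in> topspace X. q x \<in> S \<inter> T} =
        {x \<in> topspace X. q x \<in> S} \<inter> {x \<in> topspace X. q x \<in> T}" by blast
    ultimately show "S \<inter> T \<subseteq> q ` topspace X" "openin X {x \<in> topspace X. q x \<in> S \<inter> T}"
      by (auto intro: openin_Int)
  next
    fix \<K>
    assume *: "\<forall>K\<in>\<K>. K \<subseteq> q ` topspace X \<and> openin X {x \<in> topspace X. q x \<in> K}"
    then show "\<Union>\<K> \<subseteq> q ` topspace X" by blast
    have "{x \<in> topspace X. q x \<in> \<Union>\<K>} = (\<Union>K\<in>\<K>. {x \<in> topspace X. q x \<in> K})" by blast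
    then show "openin X {x \<in> topspace X. q x \<in> \<Union>\<K>}" using * by auto
  qed
  then show ?thesis by (simp add: quotient_topology_def)
qed

lemma quotient_map_quotient_topology: "quotient_map X (quotient_topology X q) q"
proof -
  have "openin (quotient_topology X q) (q ` topspace X)"
    by (auto simp: openin_quotient_topology intro: openin_subopen[THEN iffD2])
  then have "topspace (quotient_topology X q) = q ` topspace X"
    by (metis openin_quotient_topology openin_subset openin_topspace subset_antisym)
  then show ?thesis by (simp add: quotient_map_def openin_quotient_topology)
qed

definition quotient_group :: "'a topgroup \<Rightarrow> 'a set \<Rightarrow> 'a set topgroup" where
  "quotient_group V W =
     \<lparr>carrier = rcosets\<^bsub>V\<^esub> W, mult = set_mult V, one = W,
      topol = quotient_topology (topol V) (\<lambda>v. W #>\<^bsub>V\<^esub> v)\<rparr>"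

definition quotient_proj :: "'a topgroup \<Rightarrow> 'a set \<Rightarrow> 'a \<Rightarrow> 'a set" where
  "quotient_proj V W = (\<lambda>v\<in>carrier V. W #>\<^bsub>V\<^esub> v)"


section \<open>Left modules\<close>

text \<open>The locale \<open>module\<close> of the library requires a commutative ring of scalars.\<close>

locale left_module = R?: ring R + M?: abelian_group M for R (structure) and M (structure) +
  assumes smult_closed:
      "\<lbrakk>a \<in> carrier R; x \<in> carrier M\<rbrakk> \<Longrightarrow> a \<odot>\<^bsub>M\<^esub> x \<in> carrier M"
    and smult_l_distr:
      "\<lbrakk>a \<in> carrier R; b \<in> carrier R; x \<in> carrier M\<rbrakk> \<Longrightarrow>
       (a \<oplus>\<^bsub>R\<^esub> b) \<odot>\<^bsub>M\<^esub> x = a \<odot>\<^bsub>M\<^esub> x \<oplus>\<^bsub>M\<^esub> b \<odot>\<^bsub>M\<^esub> x"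
    and smult_r_distr:
      "\<lbrakk>a \<in> carrier R; x \<in> carrier M; y \<in> carrier M\<rbrakk> \<Longrightarrow>
       a \<odot>\<^bsub>M\<^esub> (x \<oplus>\<^bsub>M\<^esub> y) = a \<odot>\<^bsub>M\<^esub> x \<oplus>\<^bsub>M\<^esub> a \<odot>\<^bsub>M\<^esub> y"
    and smult_assoc1:
      "\<lbrakk>a \<in> carrier R; b \<in> carrier R; x \<in> carrier M\<rbrakk> \<Longrightarrow>
       (a \<otimes>\<^bsub>R\<^esub> b) \<odot>\<^bsub>M\<^esub> x = a \<odot>\<^bsub>M\<^esub> (b \<odot>\<^bsub>M\<^esub> x)"
    and smult_one:
      "x \<in> carrier M \<Longrightarrow> \<one>\<^bsub>R\<^esub> \<odot>\<^bsub>M\<^esub> x = x"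

definition mod_hom :: "'r ring \<Rightarrow> ('r, 'a) module \<Rightarrow> ('r, 'b) module \<Rightarrow> ('a \<Rightarrow> 'b) set" where
  "mod_hom R M N =
     {f \<in> carrier M \<rightarrow>\<^sub>E carrier N.
        (\<forall>x\<in>carrier M. \<forall>y\<in>carrier M. f (x \<oplus>\<^bsub>M\<^esub> y) = f x \<oplus>\<^bsub>N\<^esub> f y) \<and>
        (\<forall>r\<in>carrier R. \<forall>x\<in>carrier M. f (r \<odot>\<^bsub>M\<^esub> x) = r \<odot>\<^bsub>N\<^esub> f x)}"

definition mod_iso :: "'r ring \<Rightarrow> ('r, 'a) module \<Rightarrow> ('r, 'b) module \<Rightarrow> ('a \<Rightarrow> 'b) set" where
  "mod_iso R M N = {f \<in> mod_hom R M N. bij_betw f (carrier M) (carrier N)}"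

text \<open>The record type \<open>module\<close> extends that of rings; its fields \<open>mult\<close> and \<open>one\<close> play no role
  for modules and are left undefined here and below.\<close>

definition quotient_module :: "('r, 'a) module \<Rightarrow> 'a set \<Rightarrow> ('r, 'a set) module" where
  "quotient_module M N =
     \<lparr>carrier = a_rcosets\<^bsub>M\<^esub> N, mult = undefined, one = undefined,
      zero = N, add = set_add M,
      smult = (\<lambda>r X. \<Union>x\<in>X. N +>\<^bsub>M\<^esub> (r \<odot>\<^bsub>M\<^esub> x))\<rparr>"


section \<open>Column-finite matrices and modules of null sequences\<close>

text \<open>In an entry \<open>c k n\<close>, \<open>k\<close> is the row and \<open>n\<close> the column.\<close>

definition colfin_matrix_ring :: "(nat \<Rightarrow> nat \<Rightarrow> int) ring"  (\<open>\<M>\<close>) where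
  "colfin_matrix_ring =
     \<lparr>carrier = {c. \<forall>n. finite {k. c k n \<noteq> 0}},
      mult = (\<lambda>c d k n. \<Sum>m | d m n \<noteq> 0. c k m * d m n),
      one = (\<lambda>k n. if k = n then 1 else 0),
      zero = (\<lambda>k n. 0),
      add = (\<lambda>c d k n. c k n + d k n)\<rparr>"

definition group_sum :: "'a topgroup \<Rightarrow> (nat \<Rightarrow> 'a) \<Rightarrow> 'a" where
  "group_sum V t = (THE l. limitin (topol V) (\<lambda>N. finprod V t {..<N}) l sequentially)"

definition bullet :: "'a topgroup \<Rightarrow> (nat \<Rightarrow> nat \<Rightarrow> int, nat \<Rightarrow> 'a) module" where
  "bullet V =
     \<lparr>carrier = {s. range s \<subseteq> carrier V \<and> limitin (topol V) s \<one>\<^bsub>V\<^esub> sequentially},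
      mult = undefined, one = undefined,
      zero = (\<lambda>n. \<one>\<^bsub>V\<^esub>),
      add = (\<lambda>s t n. s n \<otimes>\<^bsub>V\<^esub> t n),
      smult = (\<lambda>c s k. group_sum V (\<lambda>n. s n [^]\<^bsub>V\<^esub> c k n))\<rparr>"

definition bullet_map :: "'a topgroup \<Rightarrow> ('a \<Rightarrow> 'b) \<Rightarrow> (nat \<Rightarrow> 'a) \<Rightarrow> (nat \<Rightarrow> 'b)" where
  "bullet_map V f = (\<lambda>s\<in>carrier (bullet V). \<lambda>n. f (s n))"

end

theory Submission
  imports Defs "HOL-Algebra.Generated_Groups"
begin

text \<open>A complete metrizable linear group \<open>V\<close> is the same thing as an abelian group with a decreasing
  sequence of subgroups \<open>U n\<close> that is separated and complete, and everything about null sequences is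
  checked modulo each \<open>U n\<close>, where infinite sums become finite. Matrices with a single entry show that
  an \<open>\<M>\<close>-linear map \<open>V\<^sub>\<bullet> \<rightarrow> V'\<^sub>\<bullet>\<close> is the entrywise application of a homomorphism \<open>f\<close>; as it sends null
  sequences to null sequences, \<open>f\<close> is sequentially continuous, hence continuous by metrizability.
  For quotients, the images of the \<open>U n\<close> form such a sequence of subgroups of \<open>V/W\<close>; null sequences
  and Cauchy sequences lift to \<open>V\<close> because the \<open>n\<close>-th term can be lifted as deep into the \<open>U k\<close> as its
  coset allows.\<close>

section \<open>Congruences modulo a subgroup\<close>

text \<open>Completeness is given through the limit over all open subgroups, a family that is
  awkward to follow when passing to \<open>W\<close> and to \<open>V/W\<close>. A countable cofinal
  chain is easy to follow: it becomes \<open>U n \<inter> W\<close> in the subgroup and the image of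
  \<open>U n\<close> in the quotient. Countability is decisive for the quotient: over a general
  directed index set a compatible family of cosets need not lift to a compatible family in
  \<open>V\<close>, whereas along a sequence the lifts can be built one after another. Closedness of
  \<open>W\<close> enters twice: limits of sequences in \<open>W\<close> stay in \<open>W\<close>,
  and an element that is a product of \<open>W\<close> and \<open>U n\<close> for every
  \<open>n\<close> lies in \<open>W\<close>, which makes \<open>V/W\<close> separated. The two
  halves of full faithfulness use the matrices differently. Fullness works with single-entry
  matrices, and the continuity of \<open>f\<close> comes from the target consisting of null
  sequences. Rows with infinitely many entries matter in the other direction, where continuity makes
  a homomorphism commute with infinite sums.\<close>

text \<open>Membership of both arguments in the carrier is part of the relation, so that conditions
  on sequences can be stated by congruences alone.\<close>

definition cong_mod :: "('a, 'b) monoid_scheme \<Rightarrow> 'a set \<Rightarrow> 'a \<Rightarrow> 'a \<Rightarrow> bool" where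
  "cong_mod G H x y \<longleftrightarrow> x \<in> carrier G \<and> y \<in> carrier G \<and> x \<otimes>\<^bsub>G\<^esub> inv\<^bsub>G\<^esub> y \<in> H"

lemma cong_mod_carrier:
  assumes "cong_mod G H x y"
  shows "x \<in> carrier G" "y \<in> carrier G"
  using assms by (auto simp: cong_mod_def)

lemma cong_mod_mono: "cong_mod G H x y \<Longrightarrow> H \<subseteq> H' \<Longrightarrow> cong_mod G H' x y"
  by (auto simp: cong_mod_def)

context comm_group
begin

lemma cong_mod_refl: "subgroup H G \<Longrightarrow> x \<in> carrier G \<Longrightarrow> cong_mod G H x x"
  by (simp add: cong_mod_def subgroup.one_closed)

lemma cong_mod_sym:
  assumes "subgroup H G" "cong_mod G H x y"
  shows "cong_mod G H y x"
proof -
  have "inv (x \<otimes> inv y) \<in> H"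
    using assms by (auto simp: cong_mod_def subgroup.m_inv_closed)
  then show ?thesis
    using assms by (auto simp: cong_mod_def inv_mult m_comm)
qed

lemma cong_mod_trans:
  assumes "subgroup H G" "cong_mod G H x y" "cong_mod G H y z"
  shows "cong_mod G H x z"
proof -
  have "(x \<otimes> inv y) \<otimes> (y \<otimes> inv z) \<in> H"
    using assms by (auto simp: cong_mod_def subgroup.m_closed)
  moreover have "(x \<otimes> inv y) \<otimes> (y \<otimes> inv z) = x \<otimes> inv z"
    using assms by (simp add: cong_mod_def m_assoc) (simp add: m_assoc[symmetric])
  ultimately show ?thesis
    using assms by (auto simp: cong_mod_def)
qed

lemma cong_mod_mult:
  assumes "subgroup H G" "cong_mod G H x y" "cong_mod G H x' y'"
  shows "cong_mod G H (x \<otimes> x') (y \<otimes> y')"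
proof -
  have "(x \<otimes> inv y) \<otimes> (x' \<otimes> inv y') \<in> H"
    using assms by (auto simp: cong_mod_def subgroup.m_closed)
  moreover have "(x \<otimes> inv y) \<otimes> (x' \<otimes> inv y') = x \<otimes> x' \<otimes> inv (y \<otimes> y')"
    using assms by (simp add: cong_mod_def m_ac inv_mult)
  ultimately show ?thesis
    using assms by (auto simp: cong_mod_def)
qed

lemma cong_mod_inv:
  assumes "subgroup H G" "cong_mod G H x y"
  shows "cong_mod G H (inv x) (inv y)"
proof -
  have "inv (x \<otimes> inv y) \<in> H"
    using assms by (auto simp: cong_mod_def subgroup.m_inv_closed)
  then show ?thesis
    using assms by (auto simp: cong_mod_def inv_mult)
qed

lemma cong_mod_one_iff: "subgroup H G \<Longrightarrow> cong_mod G H x \<one> \<longleftrightarrow> x \<in> H"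
  using subgroup.subset by (fastforce simp: cong_mod_def)

lemma cong_mod_mem:
  assumes "subgroup H G" "cong_mod G H x y" "y \<in> H"
  shows "x \<in> H"
  using assms cong_mod_one_iff cong_mod_trans by blast

text \<open>Translates between congruences, in which the estimates are done, and cosets, in which
  \<open>completion\<close> and \<open>quotient_group\<close> are phrased.\<close>

lemma cong_mod_rcos_iff:
  assumes "subgroup H G"
  shows "cong_mod G H x y \<longleftrightarrow> x \<in> carrier G \<and> y \<in> carrier G \<and> H #> x = H #> y"
proof -
  have "x \<otimes> inv y \<in> H \<longleftrightarrow> H #> x = H #> y" if "x \<in> carrier G" "y \<in> carrier G"
  proof -
    have "x \<otimes> inv y \<in> H \<longleftrightarrow> x \<in> H #> y"
      using assms that
      by (metis subgroup.rcos_module is_group)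
    also have "\<dots> \<longleftrightarrow> H #> x = H #> y"
      using assms that by (metis rcos_self repr_independence)
    finally show ?thesis .
  qed
  then show ?thesis
    by (auto simp: cong_mod_def)
qed

text \<open>With this the transition map \<open>C \<mapsto> H' <#> C\<close> of
  \<open>completion\<close> sends the coset \<open>H #> x\<close> to \<open>H' #> x\<close>.\<close>

lemma subgroup_mult_absorb:
  assumes H: "subgroup H G" and H': "subgroup H' G" and "H \<subseteq> H'"
  shows "H' <#> H = H'"
proof
  show "H' <#> H \<subseteq> H'"
    using assms subgroup.m_closed[OF H'] unfolding set_mult_def by blast
  show "H' \<subseteq> H' <#> H"
  proof
    fix h assume "h \<in> H'"
    then have "h = h \<otimes> \<one>"
      using subgroup.mem_carrier[OF H'] by simp
    then show "h \<in> H' <#> H"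
      using \<open>h \<in> H'\<close> subgroup.one_closed[OF H] unfolding set_mult_def by blast
  qed
qed

lemma cong_mod_finprod:
  assumes H: "subgroup H G" and "\<And>i. i \<in> A \<Longrightarrow> cong_mod G H (f i) (g i)"
  shows "cong_mod G H (finprod G f A) (finprod G g A)"
  using assms(2)
proof (induction A rule: infinite_finite_induct)
  case (insert a A)
  then have "f \<in> insert a A \<rightarrow> carrier G" "g \<in> insert a A \<rightarrow> carrier G"
    by (meson Pi_I cong_mod_carrier)+
  with insert show ?case
    by (simp add: H Pi_def cong_mod_mult)
qed (auto simp: H cong_mod_refl)

lemma cong_mod_int_pow:
  assumes "subgroup H G" "cong_mod G H x y"
  shows "cong_mod G H (x [^] (k::int)) (y [^] k)"
proof -
  have "(x \<otimes> inv y) [^] k \<in> H"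
    using assms by (auto simp: cong_mod_def subgroup_int_pow_closed)
  then show ?thesis
    using assms by (auto simp: cong_mod_def int_pow_distrib int_pow_inv)
qed

lemma finprod_int_pow:
  assumes "f \<in> A \<rightarrow> carrier G"
  shows "finprod G f A [^] (k::int) = finprod G (\<lambda>i. f i [^] k) A"
  using assms
proof (induction A rule: infinite_finite_induct)
  case (insert a A)
  then show ?case
    by (simp add: Pi_def int_pow_distrib)
qed auto

lemma int_pow_sum:
  assumes "x \<in> carrier G"
  shows "x [^] (\<Sum>i\<in>A. (c i :: int)) = finprod G (\<lambda>i. x [^] c i) A"
proof (induction A rule: infinite_finite_induct)
  case (insert a A)
  then show ?case
    using assms by (simp add: Pi_def int_pow_mult)
qed auto

lemma finprod_swap:
  assumes "finite B" "\<And>i j. i \<in> A \<Longrightarrow> j \<in> B \<Longrightarrow> f i j \<in> carrier G"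
  shows "finprod G (\<lambda>i. finprod G (f i) B) A = finprod G (\<lambda>j. finprod G (\<lambda>i. f i j) A) B"
  using assms
proof (induction B rule: finite_induct)
  case empty
  then show ?case by (simp add: finprod_one_eqI)
next
  case (insert b B)
  have "finprod G (\<lambda>i. finprod G (f i) (insert b B)) A =
      finprod G (\<lambda>i. f i b \<otimes> finprod G (f i) B) A"
    using insert by (intro finprod_cong) (auto simp: Pi_def simp_implies_def)
  also have "\<dots> = finprod G (\<lambda>i. f i b) A \<otimes> finprod G (\<lambda>i. finprod G (f i) B) A"
    using insert by (intro finprod_multf) auto
  also have "finprod G (\<lambda>i. finprod G (f i) B) A = finprod G (\<lambda>j. finprod G (\<lambda>i. f i j) A) B"
    using insert by auto
  also have "finprod G (\<lambda>i. f i b) A \<otimes> finprod G (\<lambda>j. finprod G (\<lambda>i. f i j) A) B =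
      finprod G (\<lambda>j. finprod G (\<lambda>i. f i j) A) (insert b B)"
    using insert by (subst finprod_insert) auto
  finally show ?case .
qed

end

section \<open>Complete filtered groups\<close>

text \<open>The axiom \<open>openin_iff\<close> makes the cosets of the \<open>U n\<close> a basis
  of the topology. A sequence as in \<open>complete\<close> is a compatible choice of
  representatives for a point of the limit of the groups \<open>V/U n\<close>, and \<open>l\<close>
  represents that point, which is why the index is \<open>n\<close> on both sides. Together with
  \<open>separated\<close> this says that \<open>V\<close> maps bijectively onto that limit.\<close>

locale complete_filtered_group = comm_group V for V :: "'a topgroup" (structure) +
  fixes U :: "nat \<Rightarrow> 'a set"
  assumes subgroup_U: "subgroup (U n) V"
    and U_Suc: "U (Suc n) \<subseteq> U n"
    and openin_iff: "openin (topol V) S \<longleftrightarrow>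
      S \<subseteq> carrier V \<and> (\<forall>x\<in>S. \<exists>n. \<forall>y. cong_mod V (U n) y x \<longrightarrow> y \<in> S)"
    and separated: "(\<And>n. x \<in> U n) \<Longrightarrow> x = \<one>"
    and complete: "(\<And>n. cong_mod V (U n) (s (Suc n)) (s n)) \<Longrightarrow> \<exists>l. \<forall>n. cong_mod V (U n) (s n) l"
begin

lemma U_antimono: "m \<le> n \<Longrightarrow> U n \<subseteq> U m"
  using U_Suc by (rule lift_Suc_antimono_le)

lemma U_subset: "U n \<subseteq> carrier V"
  using subgroup_U by (rule subgroup.subset)

lemmas U_refl = cong_mod_refl[OF subgroup_U]
  and U_sym = cong_mod_sym[OF subgroup_U]
  and U_trans = cong_mod_trans[OF subgroup_U]
  and U_mult = cong_mod_mult[OF subgroup_U]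
  and U_inv = cong_mod_inv[OF subgroup_U]
  and U_finprod = cong_mod_finprod[OF subgroup_U]
  and U_int_pow = cong_mod_int_pow[OF subgroup_U]
  and U_one_iff = cong_mod_one_iff[OF subgroup_U]

lemma U_mono: "cong_mod V (U n) x y \<Longrightarrow> m \<le> n \<Longrightarrow> cong_mod V (U m) x y"
  using U_antimono cong_mod_mono by metis

lemma eq_if_cong_U:
  assumes "\<And>n. cong_mod V (U n) x y"
  shows "x = y"
proof -
  have "x \<otimes> inv y = \<one>" "x \<in> carrier V" "y \<in> carrier V"
    using assms by (auto simp: cong_mod_def intro: separated)
  then show ?thesis
    by (metis inv_closed inv_equality inv_inv)
qed

lemma topspace_topol [simp]: "topspace (topol V) = carrier V"
proof -
  have "openin (topol V) (carrier V)"
    by (auto simp: openin_iff cong_mod_def)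
  moreover have "topspace (topol V) \<subseteq> carrier V"
    using openin_topspace openin_iff by blast
  ultimately show ?thesis
    using openin_subset by blast
qed

lemma openin_ball: "x \<in> carrier V \<Longrightarrow> openin (topol V) {y. cong_mod V (U n) y x}"
  unfolding openin_iff by (auto dest: cong_mod_carrier intro: U_trans)

text \<open>One \<open>U n\<close> inside \<open>H\<close> suffices because \<open>H\<close> is then
  stable under congruence modulo \<open>U n\<close>. This makes the \<open>U n\<close> cofinal among
  the open subgroups.\<close>

lemma openin_subgroup_iff:
  assumes "subgroup H V"
  shows "openin (topol V) H \<longleftrightarrow> (\<exists>n. U n \<subseteq> H)"
proof
  assume "openin (topol V) H"
  then obtain n where "\<forall>y. cong_mod V (U n) y \<one> \<longrightarrow> y \<in> H"
    using assms subgroup.one_closed openin_iff by metis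
  then show "\<exists>n. U n \<subseteq> H"
    using U_one_iff by blast
next
  assume "\<exists>n. U n \<subseteq> H"
  then obtain n where n: "U n \<subseteq> H" ..
  show "openin (topol V) H"
    unfolding openin_iff
    using assms n by (meson cong_mod_mem cong_mod_mono subgroup.subset)
qed

lemma open_subgroups_iff: "H \<in> open_subgroups V \<longleftrightarrow> subgroup H V \<and> (\<exists>n. U n \<subseteq> H)"
  using openin_subgroup_iff by (auto simp: open_subgroups_def)

lemma U_open_subgroup: "U n \<in> open_subgroups V"
  using open_subgroups_iff subgroup_U by blast

section \<open>Filtered groups are complete, linear and metrizable\<close>

lemma topological_abelian_group: "topological_abelian_group V"
  unfolding topological_abelian_group_def
proof (intro conjI)
  show "comm_group V" by (rule comm_group_axioms)
  show "topspace (topol V) = carrier V" by simp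
  show "continuous_map (prod_topology (topol V) (topol V)) (topol V) (\<lambda>(x, y). x \<otimes> y)"
    unfolding continuous_map_def
  proof (intro conjI allI impI)
    fix S assume S: "openin (topol V) S"
    show "openin (prod_topology (topol V) (topol V))
      {x \<in> topspace (prod_topology (topol V) (topol V)). (case x of (x, y) \<Rightarrow> x \<otimes> y) \<in> S}"
      unfolding openin_prod_topology_alt
    proof (intro allI impI)
      fix x y
      assume "(x, y) \<in> {x \<in> topspace (prod_topology (topol V) (topol V)). (case x of (x, y) \<Rightarrow> x \<otimes> y) \<in> S}"
      then have xy: "x \<in> carrier V" "y \<in> carrier V" "x \<otimes> y \<in> S"
        by auto
      then obtain n where n: "\<forall>z. cong_mod V (U n) z (x \<otimes> y) \<longrightarrow> z \<in> S"
        using S openin_iff by metis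
      moreover have "{z. cong_mod V (U n) z x} \<times> {z. cong_mod V (U n) z y} \<subseteq>
          {x \<in> topspace (prod_topology (topol V) (topol V)). (case x of (x, y) \<Rightarrow> x \<otimes> y) \<in> S}"
        using n U_mult by (auto dest: cong_mod_carrier)
      moreover have "openin (topol V) {z. cong_mod V (U n) z x}" "openin (topol V) {z. cong_mod V (U n) z y}"
        "x \<in> {z. cong_mod V (U n) z x}" "y \<in> {z. cong_mod V (U n) z y}"
        using xy openin_ball U_refl by simp_all
      ultimately show "\<exists>A B. openin (topol V) A \<and> openin (topol V) B \<and> x \<in> A \<and> y \<in> B \<and>
          A \<times> B \<subseteq> {x \<in> topspace (prod_topology (topol V) (topol V)). (case x of (x, y) \<Rightarrow> x \<otimes> y) \<in> S}"
        by meson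
    qed
  qed auto
  show "continuous_map (topol V) (topol V) (\<lambda>x. inv x)"
    unfolding continuous_map_def
  proof (intro conjI allI impI)
    fix S assume S: "openin (topol V) S"
    show "openin (topol V) {x \<in> topspace (topol V). inv x \<in> S}"
      unfolding openin_iff
    proof (intro conjI ballI)
      fix x assume x: "x \<in> {x \<in> topspace (topol V). inv x \<in> S}"
      then obtain n where "\<forall>z. cong_mod V (U n) z (inv x) \<longrightarrow> z \<in> S"
        using S openin_iff by auto
      then show "\<exists>n. \<forall>y. cong_mod V (U n) y x \<longrightarrow> y \<in> {x \<in> topspace (topol V). inv x \<in> S}"
        using U_inv[of n _ x] by (intro exI[of _ n]) (auto dest: cong_mod_carrier)
    qed auto
  qed auto
qed

lemma linear_abelian_group: "linear_abelian_group V"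
  unfolding linear_abelian_group_def
proof (intro conjI allI impI)
  fix N assume "openin (topol V) N \<and> \<one> \<in> N"
  then obtain n where "\<forall>y. cong_mod V (U n) y \<one> \<longrightarrow> y \<in> N"
    using openin_iff by metis
  then show "\<exists>U\<in>open_subgroups V. U \<subseteq> N"
    using U_one_iff U_open_subgroup by blast
qed (rule topological_abelian_group)

text \<open>A general cofinal family is allowed because two are needed: all open subgroups give the
  map to the completion, and \<open>range U\<close> embeds \<open>V\<close> into a countable product
  of discrete spaces. Injectivity comes from separation; the map is open onto its image because
  fixing one coordinate \<open>H \<subseteq> U n\<close> confines a point to a coset of
  \<open>U n\<close>.\<close>

lemma homeomorphic_coset_map:
  assumes "\<U> \<subseteq> open_subgroups V" and cofinal: "\<And>n. \<exists>H\<in>\<U>. H \<subseteq> U n"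
  defines "f \<equiv> \<lambda>v. \<lambda>H\<in>\<U>. H #> v"
  shows "homeomorphic_map (topol V)
    (subtopology (product_topology (\<lambda>H. discrete_topology (rcosets H)) \<U>) (f ` carrier V)) f"
    (is "homeomorphic_map _ (subtopology ?P _) f")
proof (rule bijective_open_imp_homeomorphic_map)
  have sub: "subgroup H V" if "H \<in> \<U>" for H
    using that assms(1) by (auto simp: open_subgroups_iff)
  have f_PiE: "f v \<in> (\<Pi>\<^sub>E H\<in>\<U>. rcosets H)" if "v \<in> carrier V" for v
    using that sub unfolding f_def by (auto simp: rcosetsI subgroup.subset)
  have cont: "continuous_map (topol V) (discrete_topology (rcosets H)) (\<lambda>v. f v H)" if H: "H \<in> \<U>" for H
  proof -
    \<comment> \<open>Each coordinate is locally constant: a coset of \<open>H\<close> is a union of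
      cosets of any \<open>U n\<close> below it.\<close>
    obtain n where n: "U n \<subseteq> H"
      using H assms(1) open_subgroups_iff by blast
    show ?thesis
      unfolding continuous_map_def
    proof (intro conjI allI impI)
      show "(\<lambda>v. f v H) \<in> topspace (topol V) \<rightarrow> topspace (discrete_topology (rcosets H))"
        using f_PiE H by auto
      fix S
      show "openin (topol V) {x \<in> topspace (topol V). f x H \<in> S}"
        unfolding openin_iff
      proof (intro conjI ballI)
        fix x assume x: "x \<in> {x \<in> topspace (topol V). f x H \<in> S}"
        have "f y H = f x H" if "cong_mod V (U n) y x" for y
          using that n H cong_mod_mono[OF that n] cong_mod_rcos_iff[OF sub[OF H]] by (auto simp: f_def)
        then show "\<exists>n. \<forall>y. cong_mod V (U n) y x \<longrightarrow> y \<in> {x \<in> topspace (topol V). f x H \<in> S}"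
          using x by (metis (mono_tags, lifting) cong_mod_carrier(1) mem_Collect_eq topspace_topol)
      qed auto
    qed
  qed
  show "continuous_map (topol V) (subtopology ?P (f ` carrier V)) f"
    using cont unfolding continuous_map_in_subtopology continuous_map_componentwise
    by (auto simp: f_def)
  show "f ` topspace (topol V) = topspace (subtopology ?P (f ` carrier V))"
    using f_PiE by auto
  show "inj_on f (topspace (topol V))"
  proof (rule inj_onI)
    fix x y assume xy: "x \<in> topspace (topol V)" "y \<in> topspace (topol V)" and eq: "f x = f y"
    show "x = y"
    proof (rule eq_if_cong_U)
      fix n
      obtain H where "H \<in> \<U>" "H \<subseteq> U n"
        using cofinal by blast
      then have "cong_mod V H x y"
        using xy fun_cong[OF eq, of H] by (auto simp: cong_mod_rcos_iff sub f_def)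
      then show "cong_mod V (U n) x y"
        using \<open>H \<subseteq> U n\<close> cong_mod_mono by metis
    qed
  qed
  show "open_map (topol V) (subtopology ?P (f ` carrier V)) f"
    unfolding open_map_def
  proof (intro allI impI)
    fix S assume S: "openin (topol V) S"
    show "openin (subtopology ?P (f ` carrier V)) (f ` S)"
    proof (subst openin_subopen, intro ballI)
      fix y assume "y \<in> f ` S"
      then obtain x where x: "x \<in> S" "y = f x" "x \<in> carrier V"
        using S openin_iff by blast
      obtain n where n: "\<forall>z. cong_mod V (U n) z x \<longrightarrow> z \<in> S"
        using S x openin_iff by blast
      obtain H where H: "H \<in> \<U>" "H \<subseteq> U n"
        using cofinal by blast
      let ?T = "{p \<in> topspace ?P. p H \<in> {H #> x}}"
      have "openin ?P ?T"
      proof (rule openin_continuous_map_preimage)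
        show "continuous_map ?P (discrete_topology (rcosets H)) (\<lambda>p. p H)"
          using H(1) by (rule continuous_map_product_projection)
        show "openin (discrete_topology (rcosets H)) {H #> x}"
          using x H sub by (auto simp: rcosetsI subgroup.subset)
      qed
      then have "openin (subtopology ?P (f ` carrier V)) (?T \<inter> f ` carrier V)"
        by (auto simp: openin_subtopology)
      moreover have "y \<in> ?T \<inter> f ` carrier V"
        using x H f_PiE by (auto simp: f_def)
      moreover have "?T \<inter> f ` carrier V \<subseteq> f ` S"
      proof
        fix q assume "q \<in> ?T \<inter> f ` carrier V"
        then obtain z where z: "q = f z" "z \<in> carrier V" "H #> z = H #> x"
          using H by (auto simp: f_def)
        then have "cong_mod V H z x"
          using x(3) cong_mod_rcos_iff[OF sub[OF H(1)]] by blast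
        then have "z \<in> S"
          using n cong_mod_mono[OF _ H(2)] by blast
        then show "q \<in> f ` S"
          using z(1) by blast
      qed
      ultimately show "\<exists>T. openin (subtopology ?P (f ` carrier V)) T \<and> y \<in> T \<and> T \<subseteq> f ` S"
        by blast
    qed
  qed
qed

text \<open>The filtration is a sequence, so the product of discrete spaces has a countable index
  set and is metrizable, and so are its subspaces.\<close>

lemma metrizable: "metrizable_space (topol V)"
proof -
  let ?P = "product_topology (\<lambda>H. discrete_topology (rcosets H)) (range U)"
  have "metrizable_space ?P"
    by (auto simp: metrizable_space_product_topology)
  then have "metrizable_space (subtopology ?P S)" for S
    by (rule metrizable_space_subtopology)
  moreover have "topol V homeomorphic_space
      subtopology ?P ((\<lambda>v. \<lambda>H\<in>range U. H #> v) ` carrier V)"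
    using homeomorphic_coset_map[of "range U"] U_open_subgroup
    by (intro homeomorphic_map_imp_homeomorphic_space[OF homeomorphic_coset_map]) blast+
  ultimately show ?thesis
    using homeomorphic_metrizable_space by blast
qed

text \<open>By cofinality a compatible family is determined by its values at the \<open>U n\<close>.
  Representatives of these form a sequence to which \<open>complete\<close> applies, and the limit
  represents every member of the family.\<close>

lemma coset_map_surj:
  assumes p: "p \<in> completion_carrier V"
  shows "p \<in> (\<lambda>v. \<lambda>H\<in>open_subgroups V. H #> v) ` carrier V"
proof -
  have p_rcosets: "p H \<in> rcosets H" if "H \<in> open_subgroups V" for H
    using p that by (auto simp: completion_carrier_def)
  have "\<exists>x. \<forall>n. x n \<in> carrier V \<and> p (U n) = U n #> x n"
    using p_rcosets[OF U_open_subgroup] unfolding RCOSETS_def by (intro choice) blast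
  then obtain x where x: "\<And>n. x n \<in> carrier V" "\<And>n. p (U n) = U n #> x n"
    by blast
  \<comment> \<open>Any \<open>U n\<close> below \<open>H\<close> determines the coordinate at
    \<open>H\<close>. For \<open>H = U n\<close> and the representative \<open>x (Suc n)\<close>
    this gives the congruence required by \<open>complete\<close>; for general \<open>H\<close> it
    shows that the limit represents \<open>p H\<close>.\<close>
  have p_coset: "p H = H #> x n" if "H \<in> open_subgroups V" "U n \<subseteq> H" for H n
  proof -
    have H: "subgroup H V"
      using that open_subgroups_iff by blast
    have "p H = H <#> p (U n)"
      using p that U_open_subgroup by (auto simp: completion_carrier_def)
    also have "\<dots> = (H <#> U n) #> x n"
      using x H U_subset by (simp add: setmult_rcos_assoc subgroup.subset)
    also have "H <#> U n = H"
      using H that subgroup_U subgroup_mult_absorb by blast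
    finally show ?thesis .
  qed
  have "cong_mod V (U n) (x (Suc n)) (x n)" for n
    using p_coset[OF U_open_subgroup U_Suc] x by (simp add: cong_mod_rcos_iff subgroup_U)
  then obtain l where l: "\<And>n. cong_mod V (U n) (x n) l"
    using complete by metis
  have "p = (\<lambda>H\<in>open_subgroups V. H #> l)"
  proof
    fix H
    show "p H = (\<lambda>H\<in>open_subgroups V. H #> l) H"
    proof (cases "H \<in> open_subgroups V")
      case True
      then obtain n where n: "U n \<subseteq> H" and H: "subgroup H V"
        using open_subgroups_iff by blast
      then show ?thesis
        using cong_mod_mono[OF l n] True p_coset[OF True n] by (simp add: cong_mod_rcos_iff)
    next
      case False
      then show ?thesis
        using p by (auto simp: completion_carrier_def PiE_def extensional_def)
    qed
  qed
  then show ?thesis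
    using l cong_mod_carrier by (metis imageI)
qed

lemma coset_map_in_completion:
  assumes "v \<in> carrier V"
  shows "(\<lambda>H\<in>open_subgroups V. H #> v) \<in> completion_carrier V"
proof -
  have "H' <#> (H #> v) = H' #> v"
    if "subgroup H V" "subgroup H' V" "H \<subseteq> H'" for H H'
  proof -
    have "H' <#> H = H'"
      using that subgroup_mult_absorb by blast
    then show ?thesis
      using that assms setmult_rcos_assoc subgroup.subset by metis
  qed
  then show ?thesis
    using assms by (auto simp: completion_carrier_def open_subgroups_iff rcosetsI subgroup.subset)
qed

lemma complete_linear_abelian_group: "complete_linear_abelian_group V"
  unfolding complete_linear_abelian_group_def
proof (intro conjI)
  let ?f = "\<lambda>v. \<lambda>H\<in>open_subgroups V. H #> v"
  \<comment> \<open>\<open>homeomorphic_coset_map\<close> speaks of the image of \<open>V\<close>;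
    identifying the image with the limit gives surjectivity and the right topology together.\<close>
  have img: "?f ` carrier V = completion_carrier V"
    using coset_map_surj coset_map_in_completion by auto
  have "homeomorphic_map (topol V) (topol (completion V)) ?f"
    using homeomorphic_coset_map[of "open_subgroups V"] U_open_subgroup
    unfolding img completion_def by auto
  moreover have "?f \<in> iso V (completion V)"
  proof -
    have "inj_on ?f (carrier V)"
      using calculation homeomorphic_imp_injective_map by fastforce
    moreover have "?f \<in> hom V (completion V)"
    proof (rule homI)
      fix x y assume xy: "x \<in> carrier V" "y \<in> carrier V"
      have "H #> x \<otimes> y = (H #> x) <#> (H #> y)" if "H \<in> open_subgroups V" for H
      proof -
        have "normal H V"
          using that open_subgroups_iff subgroup_imp_normal by blast
        then show ?thesis
          using xy by (simp add: normal.rcos_sum)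
      qed
      then show "?f (x \<otimes> y) = ?f x \<otimes>\<^bsub>completion V\<^esub> ?f y"
        by (simp add: completion_def cong: restrict_cong)
    qed (simp add: completion_def coset_map_in_completion)
    ultimately show ?thesis
      using img by (auto simp: iso_def bij_betw_def completion_def)
  qed
  ultimately show "?f \<in> topgroup_iso V (completion V)"
    by (simp add: topgroup_iso_def)
qed (rule linear_abelian_group)

lemma complete_metrizable: "complete_metrizable V"
  using complete_linear_abelian_group metrizable by (simp add: complete_metrizable_def)

end

section \<open>From a metrizable group to a filtration\<close>

text \<open>Metrizability supplies a countable neighbourhood base at \<open>\<one>\<close>,
  linearity replaces its members by open subgroups, and finite intersections make the chain
  decreasing. Separation is the Hausdorff property; for \<open>complete\<close>, a compatible
  sequence is extended to a family over all open subgroups.\<close>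

lemma complete_metrizable_imp_filtered:
  fixes V :: "'a topgroup" (structure)
  assumes V: "complete_metrizable V"
  obtains U where "complete_filtered_group V U"
proof -
  have lin: "linear_abelian_group V" and met: "metrizable_space (topol V)"
    and compl: "(\<lambda>v. \<lambda>U\<in>open_subgroups V. U #> v) \<in> topgroup_iso V (completion V)"
    using V by (auto simp: complete_metrizable_def complete_linear_abelian_group_def)
  have tag: "topological_abelian_group V"
    and small: "\<And>N. openin (topol V) N \<Longrightarrow> \<one> \<in> N \<Longrightarrow> \<exists>U\<in>open_subgroups V. U \<subseteq> N"
    using lin by (auto simp: linear_abelian_group_def)
  interpret comm_group V
    using tag by (simp add: topological_abelian_group_def)
  have ts: "topspace (topol V) = carrier V"
    using tag by (simp add: topological_abelian_group_def)
  \<comment> \<open>Translations are continuous, so the neighbourhoods of \<open>\<one>\<close>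
    control the topology at every point.\<close>
  have open_translate: "openin (topol V) {y \<in> carrier V. y \<otimes> a \<in> S}"
    if S: "openin (topol V) S" and a: "a \<in> carrier V" for a S
  proof -
    have "continuous_map (topol V) (prod_topology (topol V) (topol V)) (\<lambda>y. (y, a))"
      using a ts by (simp add: continuous_map_pairedI)
    moreover have "continuous_map (prod_topology (topol V) (topol V)) (topol V) (\<lambda>(x, y). x \<otimes> y)"
      using tag by (simp add: topological_abelian_group_def)
    ultimately have "continuous_map (topol V) (topol V) ((\<lambda>(x, y). x \<otimes> y) \<circ> (\<lambda>y. (y, a)))"
      by (rule continuous_map_compose)
    from openin_continuous_map_preimage[OF this S] show ?thesis
      by (simp add: ts)
  qed
  have "first_countable (topol V)"
    using met by (rule metrizable_imp_first_countable)
  then obtain \<B> where \<B>: "countable \<B>" "\<And>B. B \<in> \<B> \<Longrightarrow> openin (topol V) B"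
      "\<And>S. openin (topol V) S \<Longrightarrow> \<one> \<in> S \<Longrightarrow> \<exists>B\<in>\<B>. \<one> \<in> B \<and> B \<subseteq> S"
    unfolding first_countable_def using ts by (metis one_closed)
  have "\<B> \<noteq> {}"
    using \<B>(3)[of "carrier V"] openin_topspace[of "topol V"] ts by auto
  define B where "B = from_nat_into \<B>"
  have B: "range B = \<B>"
    using \<open>\<B> \<noteq> {}\<close> \<B>(1) by (simp add: B_def range_from_nat_into)
  \<comment> \<open>Members of the base that miss \<open>\<one>\<close> impose no condition; the
    whole group is an admissible choice for them, so that \<open>G\<close> is defined at every
    index.\<close>
  have "carrier V \<in> open_subgroups V"
    using openin_topspace[of "topol V"] subgroup_self by (auto simp: open_subgroups_def ts)
  then have "\<exists>H\<in>open_subgroups V. \<one> \<in> B n \<longrightarrow> H \<subseteq> B n" for n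
    using small[of "B n"] \<B>(2) B by blast
  then obtain G where G: "\<And>n. G n \<in> open_subgroups V" "\<And>n. \<one> \<in> B n \<Longrightarrow> G n \<subseteq> B n"
    by metis
  define U where "U n = (\<Inter>i\<le>n. G i)" for n
  have subgroup_U: "subgroup (U n) V" and open_U: "openin (topol V) (U n)" for n
  proof -
    have "subgroup (\<Inter>(G ` {..n})) V"
      using G(1) by (intro subgroups_Inter) (auto simp: open_subgroups_def)
    then show "subgroup (U n) V"
      by (simp add: U_def)
    have "openin (topol V) (\<Inter>(G ` {..n}))"
      using G(1) by (intro openin_Inter) (auto simp: open_subgroups_def)
    then show "openin (topol V) (U n)"
      by (simp add: U_def)
  qed
  have U_antimono: "m \<le> n \<Longrightarrow> U n \<subseteq> U m" for m n
    by (auto simp: U_def)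
  have U_small: "\<exists>n. U n \<subseteq> S" if S: "openin (topol V) S" "\<one> \<in> S" for S
  proof -
    obtain n where "\<one> \<in> B n" "B n \<subseteq> S"
      using \<B>(3)[OF S] B by blast
    then have "U n \<subseteq> S"
      using G(2)[of n] by (auto simp: U_def)
    then show ?thesis ..
  qed
  have open_ball: "openin (topol V) {y. cong_mod V (U n) y x}" if "x \<in> carrier V" for n x
    using open_translate[OF open_U, of "inv x" n] that by (simp add: cong_mod_def)
  have "complete_filtered_group V U"
  proof (intro complete_filtered_group.intro complete_filtered_group_axioms.intro)
    show "comm_group V"
      by (rule comm_group_axioms)
    show "subgroup (U n) V" for n
      by (rule subgroup_U)
    show "U (Suc n) \<subseteq> U n" for n
      by (simp add: U_antimono)
    show "openin (topol V) S \<longleftrightarrow>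
        S \<subseteq> carrier V \<and> (\<forall>x\<in>S. \<exists>n. \<forall>y. cong_mod V (U n) y x \<longrightarrow> y \<in> S)" for S
    proof (intro iffI conjI ballI)
      assume S: "openin (topol V) S"
      then show sub: "S \<subseteq> carrier V"
        using ts openin_subset by blast
      fix x assume "x \<in> S"
      then have x: "x \<in> S" "x \<in> carrier V"
        using sub by auto
      then obtain n where n: "U n \<subseteq> {y \<in> carrier V. y \<otimes> x \<in> S}"
        using U_small[OF open_translate[OF S, of x]] by auto
      have "y \<in> S" if y: "cong_mod V (U n) y x" for y
      proof -
        have "y \<otimes> inv x \<otimes> x \<in> S" "y \<in> carrier V"
          using n y by (auto simp: cong_mod_def)
        then show ?thesis
          using x by (simp add: m_assoc)
      qed
      then show "\<exists>n. \<forall>y. cong_mod V (U n) y x \<longrightarrow> y \<in> S"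
        by blast
    next
      assume S: "S \<subseteq> carrier V \<and> (\<forall>x\<in>S. \<exists>n. \<forall>y. cong_mod V (U n) y x \<longrightarrow> y \<in> S)"
      show "openin (topol V) S"
      proof (subst openin_subopen, intro ballI)
        fix x assume "x \<in> S"
        then obtain n where "\<forall>y. cong_mod V (U n) y x \<longrightarrow> y \<in> S" "x \<in> carrier V"
          using S by blast
        moreover from this have "x \<in> {y. cong_mod V (U n) y x}"
          using subgroup_U cong_mod_refl by simp
        ultimately show "\<exists>T. openin (topol V) T \<and> x \<in> T \<and> T \<subseteq> S"
          using open_ball[of x n] by blast
      qed
    qed
    show "x = \<one>" if x: "\<And>n. x \<in> U n" for x
    proof (rule ccontr)
      assume "x \<noteq> \<one>"
      moreover have "x \<in> carrier V"
        using x subgroup_U subgroup.mem_carrier by metis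
      moreover have "Hausdorff_space (topol V)"
        using met by (rule metrizable_imp_Hausdorff_space)
      ultimately obtain S where "openin (topol V) S" "\<one> \<in> S" "x \<notin> S"
        using ts one_closed unfolding Hausdorff_space_def disjnt_iff by metis
      then show False
        using U_small x by blast
    qed
    show "\<exists>l. \<forall>n. cong_mod V (U n) (s n) l"
      if s: "\<And>n. cong_mod V (U n) (s (Suc n)) (s n)" for s
    proof -
      have s_carrier: "s n \<in> carrier V" for n
        using cong_mod_carrier(2)[OF s] .
      have s_cong: "cong_mod V (U n) (s m) (s n)" if "n \<le> m" for n m
        using that
      proof (induction m rule: dec_induct)
        case base
        then show ?case
          by (simp add: cong_mod_refl subgroup_U s_carrier)
      next
        case (step m)
        have "cong_mod V (U n) (s (Suc m)) (s m)"
          using s[of m] U_antimono[OF step(1)] by (rule cong_mod_mono)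
        then show ?case
          using step cong_mod_trans[OF subgroup_U] by blast
      qed
      \<comment> \<open>A point of the completion needs a coset of every open subgroup
        \<open>H\<close>. It is taken as the coset of \<open>s n\<close> for some \<open>n\<close>
        with \<open>U n \<subseteq> H\<close>; by \<open>idx_cong\<close> the choice of
        \<open>n\<close> is immaterial, which yields compatibility.\<close>
      define idx where "idx H = (SOME n. U n \<subseteq> H)" for H
      have idx: "U (idx H) \<subseteq> H" if "H \<in> open_subgroups V" for H
      proof -
        have "\<exists>n. U n \<subseteq> H"
          using that U_small subgroup.one_closed by (auto simp: open_subgroups_def)
        then show ?thesis
          unfolding idx_def by (rule someI_ex)
      qed
      have idx_cong: "cong_mod V H (s n) (s (idx H))"
        if H: "H \<in> open_subgroups V" and n: "U n \<subseteq> H" for H n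
      proof -
        let ?k = "max n (idx H)"
        have "cong_mod V H (s ?k) (s n)" "cong_mod V H (s ?k) (s (idx H))"
          using cong_mod_mono[OF s_cong n] cong_mod_mono[OF s_cong idx[OF H]] by simp_all
        moreover have "subgroup H V"
          using H by (simp add: open_subgroups_def)
        ultimately show ?thesis
          using cong_mod_sym cong_mod_trans by blast
      qed
      define p where "p = (\<lambda>H\<in>open_subgroups V. H #> s (idx H))"
      have "p \<in> completion_carrier V"
      proof -
        have "H' <#> p H = p H'" if H: "H \<in> open_subgroups V" "H' \<in> open_subgroups V" "H \<subseteq> H'" for H H'
        proof -
          have sub: "subgroup H V" "subgroup H' V"
            using H by (auto simp: open_subgroups_def)
          have "H' <#> p H = H' <#> H #> s (idx H)"
            using H sub by (simp add: p_def setmult_rcos_assoc subgroup.subset s_carrier)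
          also have "H' <#> H = H'"
            using H sub by (intro subgroup_mult_absorb)
          also have "H' #> s (idx H) = H' #> s (idx H')"
            using idx_cong[of H' "idx H"] idx[of H] H cong_mod_rcos_iff[OF sub(2)] by blast
          finally show ?thesis
            using H by (simp add: p_def)
        qed
        then show ?thesis
          by (auto simp: completion_carrier_def p_def open_subgroups_def rcosetsI subgroup.subset s_carrier)
      qed
      then have "p \<in> (\<lambda>v. \<lambda>U\<in>open_subgroups V. U #> v) ` carrier V"
        using compl by (auto simp: topgroup_iso_def iso_def bij_betw_def completion_def)
      then obtain l where l: "l \<in> carrier V" "p = (\<lambda>U\<in>open_subgroups V. U #> l)"
        by blast
      have "cong_mod V (U n) (s n) l" for n
      proof -
        have Un: "U n \<in> open_subgroups V"
          using subgroup_U open_U by (simp add: open_subgroups_def)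
        have "U n #> s (idx (U n)) = U n #> l"
          using fun_cong[OF l(2), of "U n"] Un by (simp add: p_def)
        then have "cong_mod V (U n) (s (idx (U n))) l"
          using l(1) s_carrier by (simp add: cong_mod_rcos_iff subgroup_U)
        \<comment> \<open>The index \<open>idx (U n)\<close> need not be \<open>n\<close>;
          \<open>idx_cong\<close> leads back to \<open>s n\<close>.\<close>
        then show ?thesis
          using idx_cong[OF Un order_refl] cong_mod_trans[OF subgroup_U] by blast
      qed
      then show ?thesis
        by blast
    qed
  qed
  then show thesis
    by (rule that)
qed

section \<open>Null sequences and column-finite matrices\<close>

lemma finite_support_iff:
  fixes f :: "nat \<Rightarrow> int"
  shows "finite {k. f k \<noteq> 0} \<longleftrightarrow> (\<exists>M. \<forall>k\<ge>M. f k = 0)"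
proof
  assume "finite {k. f k \<noteq> 0}"
  then obtain M where "\<forall>k\<in>{k. f k \<noteq> 0}. k < M"
    using finite_nat_set_iff_bounded by blast
  then show "\<exists>M. \<forall>k\<ge>M. f k = 0"
    by (metis (mono_tags, lifting) mem_Collect_eq not_le)
next
  assume "\<exists>M. \<forall>k\<ge>M. f k = 0"
  then obtain M where "\<forall>k\<ge>M. f k = 0" ..
  then have "{k. f k \<noteq> 0} \<subseteq> {..<M}"
    by (auto simp: not_le[symmetric])
  then show "finite {k. f k \<noteq> 0}"
    using finite_subset by blast
qed

lemma colfin_carrier_iff: "c \<in> carrier \<M> \<longleftrightarrow> (\<forall>n. \<exists>M. \<forall>k\<ge>M. c k n = 0)"
  by (simp add: colfin_matrix_ring_def finite_support_iff)

text \<open>A bound that is uniform over finitely many columns. Modulo \<open>U j\<close> only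
  finitely many terms of a null sequence matter, and this is how column finiteness enters the
  estimates for the action.\<close>

lemma colfin_rows_vanish:
  assumes "c \<in> carrier \<M>"
  obtains M where "\<And>k n. k \<ge> M \<Longrightarrow> n < N \<Longrightarrow> c k n = 0"
proof -
  obtain M where M: "\<And>n k. k \<ge> M n \<Longrightarrow> c k n = 0"
    using assms unfolding colfin_carrier_iff by metis
  \<comment> \<open>The sum serves as an upper bound of the finitely many
    \<open>M n\<close>.\<close>
  have "c k n = 0" if "k \<ge> (\<Sum>n<N. M n)" "n < N" for k n
  proof -
    have "M n \<le> (\<Sum>n<N. M n)"
      using that by (intro member_le_sum) auto
    then show ?thesis
      using that M by auto
  qed
  then show thesis
    by (rule that)
qed

text \<open>Replaces the support of a column, over which the product is defined, by any initial
  segment containing it, so that several products can be computed over a common range.\<close>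

lemma colfin_mult_eq:
  assumes "\<And>m. m \<ge> M \<Longrightarrow> d m n = 0"
  shows "(c \<otimes>\<^bsub>\<M>\<^esub> d) k n = (\<Sum>m<M. c k m * d m n)"
proof -
  have "{m. d m n \<noteq> 0} \<subseteq> {..<M}"
    using assms by (auto simp: not_le[symmetric])
  then show ?thesis
    unfolding colfin_matrix_ring_def by (simp, intro sum.mono_neutral_left) auto
qed

lemma colfin_mult_closed:
  assumes c: "c \<in> carrier \<M>" and d: "d \<in> carrier \<M>"
  shows "c \<otimes>\<^bsub>\<M>\<^esub> d \<in> carrier \<M>"
  unfolding colfin_carrier_iff
proof
  fix n
  obtain M where M: "\<And>m. m \<ge> M \<Longrightarrow> d m n = 0"
    using d colfin_carrier_iff by metis
  obtain K where "\<And>k m. k \<ge> K \<Longrightarrow> m < M \<Longrightarrow> c k m = 0"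
    using colfin_rows_vanish[OF c] by metis
  then show "\<exists>K. \<forall>k\<ge>K. (c \<otimes>\<^bsub>\<M>\<^esub> d) k n = 0"
    using M by (intro exI[of _ K]) (simp add: colfin_mult_eq[of M d n])
qed

lemma colfin_mult_assoc:
  assumes d: "d \<in> carrier \<M>" and e: "e \<in> carrier \<M>"
  shows "c \<otimes>\<^bsub>\<M>\<^esub> d \<otimes>\<^bsub>\<M>\<^esub> e = c \<otimes>\<^bsub>\<M>\<^esub> (d \<otimes>\<^bsub>\<M>\<^esub> e)"
proof (intro ext)
  fix k n
  obtain M where M: "\<And>m. m \<ge> M \<Longrightarrow> e m n = 0"
    using e colfin_carrier_iff by metis
  \<comment> \<open>One \<open>L\<close> serves all columns \<open>m < M\<close> of
    \<open>d\<close>, so that both sides become sums over the rectangle \<open>l < L\<close>,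
    \<open>m < M\<close>.\<close>
  obtain L where L: "\<And>l m. l \<ge> L \<Longrightarrow> m < M \<Longrightarrow> d l m = 0"
    using colfin_rows_vanish[OF d] by metis
  have de: "(d \<otimes>\<^bsub>\<M>\<^esub> e) l n = (\<Sum>m<M. d l m * e m n)" for l
    using M by (rule colfin_mult_eq)
  have "(c \<otimes>\<^bsub>\<M>\<^esub> (d \<otimes>\<^bsub>\<M>\<^esub> e)) k n = (\<Sum>l<L. c k l * (d \<otimes>\<^bsub>\<M>\<^esub> e) l n)"
    by (rule colfin_mult_eq) (simp add: de L)
  also have "\<dots> = (\<Sum>m<M. \<Sum>l<L. c k l * (d l m * e m n))"
    by (subst sum.swap) (simp add: de sum_distrib_left)
  also have "\<dots> = (\<Sum>m<M. (c \<otimes>\<^bsub>\<M>\<^esub> d) k m * e m n)"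
    by (intro sum.cong refl) (simp add: colfin_mult_eq[of L d] L sum_distrib_right mult.assoc)
  also have "\<dots> = (c \<otimes>\<^bsub>\<M>\<^esub> d \<otimes>\<^bsub>\<M>\<^esub> e) k n"
    using M by (rule colfin_mult_eq[symmetric])
  finally show "(c \<otimes>\<^bsub>\<M>\<^esub> d \<otimes>\<^bsub>\<M>\<^esub> e) k n = (c \<otimes>\<^bsub>\<M>\<^esub> (d \<otimes>\<^bsub>\<M>\<^esub> e)) k n" ..
qed

lemma ring_colfin: "ring \<M>"
proof (rule ringI)
  have add: "(c \<oplus>\<^bsub>\<M>\<^esub> d) k n = c k n + d k n" for c d k n
    by (simp add: colfin_matrix_ring_def)
  have zero: "\<zero>\<^bsub>\<M>\<^esub> k n = 0" for k n
    by (simp add: colfin_matrix_ring_def)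
  have one: "\<one>\<^bsub>\<M>\<^esub> k n = (if k = n then 1 else 0)" for k n
    by (simp add: colfin_matrix_ring_def)
  have add_closed: "c \<oplus>\<^bsub>\<M>\<^esub> d \<in> carrier \<M>" if "c \<in> carrier \<M>" "d \<in> carrier \<M>" for c d
    unfolding colfin_carrier_iff
  proof
    fix n
    have "\<exists>K. \<forall>k\<ge>K. c k n = 0" "\<exists>L. \<forall>k\<ge>L. d k n = 0"
      using that by (simp_all add: colfin_carrier_iff)
    then obtain K L where "\<forall>k\<ge>K. c k n = 0" "\<forall>k\<ge>L. d k n = 0"
      by blast
    then show "\<exists>M. \<forall>k\<ge>M. (c \<oplus>\<^bsub>\<M>\<^esub> d) k n = 0"
      by (intro exI[of _ "max K L"]) (simp add: add)
  qed
  show "abelian_group \<M>"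
  proof (rule abelian_groupI)
    fix c assume c: "c \<in> carrier \<M>"
    show "\<exists>d\<in>carrier \<M>. d \<oplus>\<^bsub>\<M>\<^esub> c = \<zero>\<^bsub>\<M>\<^esub>"
      using c by (intro bexI[of _ "\<lambda>k n. - c k n"]) (auto simp: colfin_carrier_iff fun_eq_iff add zero)
  qed (auto simp: add_closed fun_eq_iff add zero, simp add: colfin_carrier_iff zero)
  have one_carrier: "\<one>\<^bsub>\<M>\<^esub> \<in> carrier \<M>"
    unfolding colfin_carrier_iff
  proof
    fix n
    show "\<exists>M. \<forall>k\<ge>M. \<one>\<^bsub>\<M>\<^esub> k n = 0"
      by (intro exI[of _ "Suc n"]) (simp add: one)
  qed
  show "monoid \<M>"
  proof (rule monoidI)
    fix c assume c: "c \<in> carrier \<M>"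
    show "\<one>\<^bsub>\<M>\<^esub> \<otimes>\<^bsub>\<M>\<^esub> c = c"
    proof (intro ext)
      fix k n
      obtain M where M: "\<And>m. m \<ge> M \<Longrightarrow> c m n = 0"
        using c colfin_carrier_iff by metis
      \<comment> \<open>The range is enlarged past \<open>k\<close> so that it contains the index
        \<open>m = k\<close> of the only term that can be nonzero.\<close>
      then have "(\<one>\<^bsub>\<M>\<^esub> \<otimes>\<^bsub>\<M>\<^esub> c) k n = (\<Sum>m<max M (Suc k). \<one>\<^bsub>\<M>\<^esub> k m * c m n)"
        by (intro colfin_mult_eq) simp
      also have "\<dots> = (\<Sum>m<max M (Suc k). if k = m then c m n else 0)"
        by (intro sum.cong) (simp_all add: one)
      also have "\<dots> = c k n"
        by (simp add: less_max_iff_disj)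
      finally show "(\<one>\<^bsub>\<M>\<^esub> \<otimes>\<^bsub>\<M>\<^esub> c) k n = c k n" .
    qed
    show "c \<otimes>\<^bsub>\<M>\<^esub> \<one>\<^bsub>\<M>\<^esub> = c"
    proof (intro ext)
      fix k n
      have "(c \<otimes>\<^bsub>\<M>\<^esub> \<one>\<^bsub>\<M>\<^esub>) k n = (\<Sum>m<Suc n. c k m * \<one>\<^bsub>\<M>\<^esub> m n)"
        by (rule colfin_mult_eq) (simp add: one)
      also have "\<dots> = c k n"
        by (simp add: one)
      finally show "(c \<otimes>\<^bsub>\<M>\<^esub> \<one>\<^bsub>\<M>\<^esub>) k n = c k n" .
    qed
  qed (simp_all add: colfin_mult_closed colfin_mult_assoc one_carrier)
  fix c d e assume cde: "c \<in> carrier \<M>" "d \<in> carrier \<M>" "e \<in> carrier \<M>"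
  show "(c \<oplus>\<^bsub>\<M>\<^esub> d) \<otimes>\<^bsub>\<M>\<^esub> e = c \<otimes>\<^bsub>\<M>\<^esub> e \<oplus>\<^bsub>\<M>\<^esub> d \<otimes>\<^bsub>\<M>\<^esub> e"
  proof (intro ext)
    fix k n
    obtain M where "\<And>m. m \<ge> M \<Longrightarrow> e m n = 0"
      using cde colfin_carrier_iff by metis
    from colfin_mult_eq[of M e n, OF this]
    show "((c \<oplus>\<^bsub>\<M>\<^esub> d) \<otimes>\<^bsub>\<M>\<^esub> e) k n = (c \<otimes>\<^bsub>\<M>\<^esub> e \<oplus>\<^bsub>\<M>\<^esub> d \<otimes>\<^bsub>\<M>\<^esub> e) k n"
      by (simp add: add algebra_simps sum.distrib)
  qed
  show "e \<otimes>\<^bsub>\<M>\<^esub> (c \<oplus>\<^bsub>\<M>\<^esub> d) = e \<otimes>\<^bsub>\<M>\<^esub> c \<oplus>\<^bsub>\<M>\<^esub> e \<otimes>\<^bsub>\<M>\<^esub> d"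
  proof (intro ext)
    fix k n
    have "\<exists>K. \<forall>k\<ge>K. c k n = 0" "\<exists>L. \<forall>k\<ge>L. d k n = 0"
      using cde by (simp_all add: colfin_carrier_iff)
    then obtain K L where "\<forall>k\<ge>K. c k n = 0" "\<forall>k\<ge>L. d k n = 0"
      by blast
    then have *: "\<And>m. m \<ge> max K L \<Longrightarrow> c m n = 0" "\<And>m. m \<ge> max K L \<Longrightarrow> d m n = 0"
      "\<And>m. m \<ge> max K L \<Longrightarrow> (c \<oplus>\<^bsub>\<M>\<^esub> d) m n = 0"
      by (simp_all add: add)
    have eq: "(e \<otimes>\<^bsub>\<M>\<^esub> x) k n = (\<Sum>m<max K L. e k m * x m n)"
      if "\<And>m. m \<ge> max K L \<Longrightarrow> x m n = 0" for x
      using that by (rule colfin_mult_eq)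
    show "(e \<otimes>\<^bsub>\<M>\<^esub> (c \<oplus>\<^bsub>\<M>\<^esub> d)) k n = (e \<otimes>\<^bsub>\<M>\<^esub> c \<oplus>\<^bsub>\<M>\<^esub> e \<otimes>\<^bsub>\<M>\<^esub> d) k n"
      using * by (simp add: eq add distrib_left sum.distrib del: max.bounded_iff)
  qed
qed

section \<open>Infinite sums and the module of null sequences\<close>

context complete_filtered_group
begin

lemma limitin_iff:
  "limitin (topol V) s l sequentially \<longleftrightarrow>
     l \<in> carrier V \<and> (\<forall>k. \<exists>N. \<forall>n\<ge>N. cong_mod V (U k) (s n) l)"
proof (intro iffI conjI allI)
  assume lim: "limitin (topol V) s l sequentially"
  then show l: "l \<in> carrier V"
    using limitin_topspace by fastforce
  fix k
  have "openin (topol V) {y. cong_mod V (U k) y l}" "l \<in> {y. cong_mod V (U k) y l}"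
    using l openin_ball U_refl by auto
  then show "\<exists>N. \<forall>n\<ge>N. cong_mod V (U k) (s n) l"
    using lim unfolding limitin_sequentially by blast
next
  assume "l \<in> carrier V \<and> (\<forall>k. \<exists>N. \<forall>n\<ge>N. cong_mod V (U k) (s n) l)"
  then show "limitin (topol V) s l sequentially"
    unfolding limitin_sequentially topspace_topol using openin_iff by metis
qed

lemma limitin_unique:
  assumes "limitin (topol V) s l sequentially" "limitin (topol V) s l' sequentially"
  shows "l = l'"
proof (rule eq_if_cong_U)
  fix k
  obtain M N where "\<forall>n\<ge>M. cong_mod V (U k) (s n) l" "\<forall>n\<ge>N. cong_mod V (U k) (s n) l'"
    using assms limitin_iff by metis
  then have "cong_mod V (U k) (s (max M N)) l" "cong_mod V (U k) (s (max M N)) l'"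
    by auto
  then show "cong_mod V (U k) l l'"
    using U_sym U_trans by blast
qed

lemma carrier_bullet_iff:
  "s \<in> carrier (bullet V) \<longleftrightarrow> (\<forall>n. s n \<in> carrier V) \<and> (\<forall>k. \<exists>N. \<forall>n\<ge>N. s n \<in> U k)"
  by (auto simp: bullet_def limitin_iff U_one_iff)

lemma bullet_closed: "s \<in> carrier (bullet V) \<Longrightarrow> s n \<in> carrier V"
  by (simp add: carrier_bullet_iff)

text \<open>The non-archimedean principle: from index \<open>N\<close> on every new factor lies in
  the subgroup \<open>U k\<close>, so the partial products stay in one coset. Tending to the neutral
  element is therefore enough for summability.\<close>

lemma finprod_cong_U:
  assumes "s \<in> carrier (bullet V)" "\<forall>n\<ge>N. s n \<in> U k" "N \<le> M"
  shows "cong_mod V (U k) (finprod V s {..<M}) (finprod V s {..<N})"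
  using \<open>N \<le> M\<close>
proof (induction M rule: dec_induct)
  case base
  then show ?case
    using assms by (intro U_refl finprod_closed) (auto simp: bullet_closed)
next
  case (step M)
  have "cong_mod V (U k) (s M) \<one>"
    using assms step by (simp add: U_one_iff)
  from U_mult[OF this step.IH] show ?case
    using assms by (simp add: lessThan_Suc Pi_def bullet_closed)
qed

lemma summable:
  assumes s: "s \<in> carrier (bullet V)"
  shows "\<exists>l. limitin (topol V) (\<lambda>N. finprod V s {..<N}) l sequentially"
proof -
  let ?p = "\<lambda>N. finprod V s {..<N}"
  obtain N where N: "\<And>k. \<forall>n\<ge>N k. s n \<in> U k"
    using s unfolding carrier_bullet_iff by metis
  \<comment> \<open>\<open>N\<close> need not be monotone, so the two partial products are compared
    through the later index \<open>?M\<close>.\<close>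
  have "cong_mod V (U k) (?p (N (Suc k))) (?p (N k))" for k
  proof -
    let ?M = "max (N k) (N (Suc k))"
    have "cong_mod V (U k) (?p ?M) (?p (N k))"
      using finprod_cong_U[OF s N] by simp
    moreover have "cong_mod V (U k) (?p ?M) (?p (N (Suc k)))"
      using U_mono[OF finprod_cong_U[OF s N]] by simp
    ultimately show ?thesis
      using U_sym U_trans by blast
  qed
  then obtain l where l: "\<And>k. cong_mod V (U k) (?p (N k)) l"
    using complete[of "\<lambda>k. ?p (N k)"] by blast
  then have "limitin (topol V) ?p l sequentially"
    unfolding limitin_iff using finprod_cong_U[OF s N] U_trans cong_mod_carrier by meson
  then show ?thesis ..
qed

lemma group_sum_eqI:
  "limitin (topol V) (\<lambda>N. finprod V s {..<N}) l sequentially \<Longrightarrow> group_sum V s = l"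
  unfolding group_sum_def using limitin_unique by (intro the_equality)

lemma group_sum_limit:
  "s \<in> carrier (bullet V) \<Longrightarrow> limitin (topol V) (\<lambda>N. finprod V s {..<N}) (group_sum V s) sequentially"
  using summable group_sum_eqI by metis

lemma group_sum_closed: "s \<in> carrier (bullet V) \<Longrightarrow> group_sum V s \<in> carrier V"
  using group_sum_limit limitin_iff by blast

text \<open>Reduces identities between infinite sums to finite products: modulo \<open>U k\<close> a
  sum is a partial product, and by \<open>eq_if_cong_U\<close> a comparison for every
  \<open>k\<close> suffices.\<close>

lemma group_sum_cong_U:
  assumes s: "s \<in> carrier (bullet V)" and N: "\<forall>n\<ge>N. s n \<in> U k"
  shows "cong_mod V (U k) (group_sum V s) (finprod V s {..<N})"
proof -
  obtain M where "\<forall>n\<ge>M. cong_mod V (U k) (finprod V s {..<n}) (group_sum V s)"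
    using group_sum_limit[OF s] limitin_iff by metis
  then have "cong_mod V (U k) (finprod V s {..<max M N}) (group_sum V s)"
    by simp
  moreover have "cong_mod V (U k) (finprod V s {..<max M N}) (finprod V s {..<N})"
    using finprod_cong_U[OF s N] by simp
  ultimately show ?thesis
    using U_sym U_trans by blast
qed

lemma bullet_one: "(\<lambda>n. \<one>) \<in> carrier (bullet V)"
  by (simp add: carrier_bullet_iff subgroup.one_closed subgroup_U)

lemma bullet_mult:
  assumes "s \<in> carrier (bullet V)" "t \<in> carrier (bullet V)"
  shows "(\<lambda>n. s n \<otimes> t n) \<in> carrier (bullet V)"
  unfolding carrier_bullet_iff
proof (intro conjI allI)
  fix k
  obtain M N where "\<forall>n\<ge>M. s n \<in> U k" "\<forall>n\<ge>N. t n \<in> U k"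
    using assms carrier_bullet_iff by metis
  then show "\<exists>N. \<forall>n\<ge>N. s n \<otimes> t n \<in> U k"
    using subgroup.m_closed[OF subgroup_U] by (intro exI[of _ "max M N"]) simp
qed (simp add: assms bullet_closed)

lemma bullet_inv:
  assumes "s \<in> carrier (bullet V)"
  shows "(\<lambda>n. inv (s n)) \<in> carrier (bullet V)"
  unfolding carrier_bullet_iff
proof (intro conjI allI)
  fix k
  obtain N where "\<forall>n\<ge>N. s n \<in> U k"
    using assms carrier_bullet_iff by metis
  then show "\<exists>N. \<forall>n\<ge>N. inv (s n) \<in> U k"
    using subgroup.m_inv_closed[OF subgroup_U] by blast
qed (simp add: assms bullet_closed)

lemma bullet_int_pow:
  assumes "s \<in> carrier (bullet V)"
  shows "(\<lambda>n. s n [^] (c n :: int)) \<in> carrier (bullet V)"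
  unfolding carrier_bullet_iff
proof (intro conjI allI)
  fix k
  obtain N where "\<forall>n\<ge>N. s n \<in> U k"
    using assms carrier_bullet_iff by metis
  then show "\<exists>N. \<forall>n\<ge>N. s n [^] c n \<in> U k"
    using subgroup_int_pow_closed[OF subgroup_U] by blast
qed (simp add: assms bullet_closed)

lemma group_sum_mult:
  assumes s: "s \<in> carrier (bullet V)" and t: "t \<in> carrier (bullet V)"
  shows "group_sum V (\<lambda>n. s n \<otimes> t n) = group_sum V s \<otimes> group_sum V t"
proof (rule eq_if_cong_U)
  fix k
  obtain M N where "\<forall>n\<ge>M. s n \<in> U k" "\<forall>n\<ge>N. t n \<in> U k"
    using assms carrier_bullet_iff by metis
  then have N: "\<forall>n\<ge>max M N. s n \<in> U k" "\<forall>n\<ge>max M N. t n \<in> U k"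
    by auto
  then have "\<forall>n\<ge>max M N. s n \<otimes> t n \<in> U k"
    using subgroup.m_closed[OF subgroup_U] by blast
  then have "cong_mod V (U k) (group_sum V (\<lambda>n. s n \<otimes> t n)) (finprod V (\<lambda>n. s n \<otimes> t n) {..<max M N})"
    using group_sum_cong_U[OF bullet_mult[OF s t]] by blast
  also have "finprod V (\<lambda>n. s n \<otimes> t n) {..<max M N} =
      finprod V s {..<max M N} \<otimes> finprod V t {..<max M N}"
    using s t by (intro finprod_multf) (auto simp: bullet_closed)
  finally show "cong_mod V (U k) (group_sum V (\<lambda>n. s n \<otimes> t n)) (group_sum V s \<otimes> group_sum V t)"
    using U_sym[OF U_mult[OF group_sum_cong_U[OF s N(1)] group_sum_cong_U[OF t N(2)]]] by (rule U_trans)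
qed

lemma smult_bullet: "(c \<odot>\<^bsub>bullet V\<^esub> s) k = group_sum V (\<lambda>n. s n [^] c k n)"
  by (simp add: bullet_def)

lemma smult_cong_U:
  assumes "s \<in> carrier (bullet V)" "\<forall>n\<ge>N. s n \<in> U j"
  shows "cong_mod V (U j) ((c \<odot>\<^bsub>bullet V\<^esub> s) k) (finprod V (\<lambda>n. s n [^] c k n) {..<N})"
  unfolding smult_bullet using assms subgroup_int_pow_closed[OF subgroup_U]
  by (intro group_sum_cong_U bullet_int_pow) auto

text \<open>The terms below \<open>N\<close> are trivial because the exponent vanishes; those from
  \<open>N\<close> on lie in \<open>U j\<close>.\<close>

lemma smult_bullet_tail:
  assumes s: "s \<in> carrier (bullet V)" and N: "\<forall>n\<ge>N. s n \<in> U j" and c: "\<And>n. n < N \<Longrightarrow> c k n = 0"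
  shows "(c \<odot>\<^bsub>bullet V\<^esub> s) k \<in> U j"
proof -
  have "finprod V (\<lambda>n. s n [^] c k n) {..<N} = \<one>"
    using c by (intro finprod_one_eqI) simp
  then show ?thesis
    using smult_cong_U[OF s N, of c k] U_one_iff by simp
qed

text \<open>Nullity and column finiteness work together: for given \<open>j\<close> only the first
  \<open>N\<close> columns matter modulo \<open>U j\<close>, and on these all rows from some
  \<open>K\<close> on vanish.\<close>

lemma smult_bullet_closed:
  assumes c: "c \<in> carrier \<M>" and s: "s \<in> carrier (bullet V)"
  shows "c \<odot>\<^bsub>bullet V\<^esub> s \<in> carrier (bullet V)"
  unfolding carrier_bullet_iff
proof (intro conjI allI)
  fix j
  obtain N where N: "\<forall>n\<ge>N. s n \<in> U j"
    using s carrier_bullet_iff by metis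
  obtain K where "\<And>k n. k \<ge> K \<Longrightarrow> n < N \<Longrightarrow> c k n = 0"
    using colfin_rows_vanish[OF c] by metis
  then show "\<exists>K. \<forall>k\<ge>K. (c \<odot>\<^bsub>bullet V\<^esub> s) k \<in> U j"
    using smult_bullet_tail[OF s N] by blast
qed (simp add: smult_bullet group_sum_closed bullet_int_pow s)

text \<open>Modulo \<open>U j\<close> both sides reduce to one double product over
  \<open>m < M\<close>, \<open>n < N\<close>. Here \<open>N\<close> cuts off \<open>s\<close>, and
  \<open>M\<close> cuts off \<open>d s\<close>, because the first \<open>N\<close> columns of
  \<open>d\<close> vanish from row \<open>M\<close> on.\<close>

lemma smult_bullet_assoc:
  assumes c: "c \<in> carrier \<M>" and d: "d \<in> carrier \<M>" and s: "s \<in> carrier (bullet V)"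
  shows "(c \<otimes>\<^bsub>\<M>\<^esub> d) \<odot>\<^bsub>bullet V\<^esub> s = c \<odot>\<^bsub>bullet V\<^esub> (d \<odot>\<^bsub>bullet V\<^esub> s)"
proof (intro ext, rule eq_if_cong_U)
  fix k j
  let ?ds = "d \<odot>\<^bsub>bullet V\<^esub> s"
  obtain N where N: "\<forall>n\<ge>N. s n \<in> U j"
    using s carrier_bullet_iff by metis
  obtain M where M: "\<And>m n. m \<ge> M \<Longrightarrow> n < N \<Longrightarrow> d m n = 0"
    using colfin_rows_vanish[OF d] by metis
  have "\<forall>m\<ge>M. ?ds m \<in> U j"
    using smult_bullet_tail[OF s N] M by blast
  then have "cong_mod V (U j) ((c \<odot>\<^bsub>bullet V\<^esub> ?ds) k) (finprod V (\<lambda>m. ?ds m [^] c k m) {..<M})"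
    by (rule smult_cong_U[OF smult_bullet_closed[OF d s]])
  moreover have "cong_mod V (U j) (finprod V (\<lambda>m. ?ds m [^] c k m) {..<M})
      (finprod V (\<lambda>m. finprod V (\<lambda>n. s n [^] d m n) {..<N} [^] c k m) {..<M})"
    by (intro U_finprod U_int_pow smult_cong_U[OF s N])
  ultimately have right: "cong_mod V (U j) ((c \<odot>\<^bsub>bullet V\<^esub> ?ds) k)
      (finprod V (\<lambda>m. finprod V (\<lambda>n. s n [^] d m n) {..<N} [^] c k m) {..<M})"
    by (rule U_trans)
  have "finprod V (\<lambda>m. finprod V (\<lambda>n. s n [^] d m n) {..<N} [^] c k m) {..<M} =
      finprod V (\<lambda>m. finprod V (\<lambda>n. s n [^] (c k m * d m n)) {..<N}) {..<M}"
    using s by (simp add: finprod_int_pow Pi_def bullet_closed int_pow_pow mult.commute)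
  also have "\<dots> = finprod V (\<lambda>n. finprod V (\<lambda>m. s n [^] (c k m * d m n)) {..<M}) {..<N}"
    using s by (intro finprod_swap) (auto simp: bullet_closed)
  also have "\<dots> = finprod V (\<lambda>n. s n [^] (c \<otimes>\<^bsub>\<M>\<^esub> d) k n) {..<N}"
  proof (rule finprod_cong')
    fix n assume "n \<in> {..<N}"
    then have "(c \<otimes>\<^bsub>\<M>\<^esub> d) k n = (\<Sum>m<M. c k m * d m n)"
      using M by (intro colfin_mult_eq) simp
    then show "finprod V (\<lambda>m. s n [^] (c k m * d m n)) {..<M} = s n [^] (c \<otimes>\<^bsub>\<M>\<^esub> d) k n"
      using s by (simp add: int_pow_sum bullet_closed)
  qed (auto simp: bullet_closed s)
  finally have "cong_mod V (U j) (((c \<otimes>\<^bsub>\<M>\<^esub> d) \<odot>\<^bsub>bullet V\<^esub> s) k)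
      (finprod V (\<lambda>m. finprod V (\<lambda>n. s n [^] d m n) {..<N} [^] c k m) {..<M})"
    using smult_cong_U[OF s N, of "c \<otimes>\<^bsub>\<M>\<^esub> d" k] by simp
  then show "cong_mod V (U j) (((c \<otimes>\<^bsub>\<M>\<^esub> d) \<odot>\<^bsub>bullet V\<^esub> s) k) ((c \<odot>\<^bsub>bullet V\<^esub> ?ds) k)"
    using U_sym[OF right] by (rule U_trans)
qed

text \<open>Sequences supported at one position serve to evaluate the unit matrix and the
  single-entry matrices, and to read off a homomorphism from its action on sequences.\<close>

lemma bullet_delta:
  assumes "x \<in> carrier V"
  shows "(\<lambda>n. if k = n then x else \<one>) \<in> carrier (bullet V)"
  unfolding carrier_bullet_iff using assms subgroup.one_closed[OF subgroup_U]
  by (intro conjI allI exI[of _ "Suc k"]) auto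

lemma group_sum_delta:
  assumes "x \<in> carrier V"
  shows "group_sum V (\<lambda>n. if k = n then x else \<one>) = x"
proof (rule eq_if_cong_U)
  fix j
  let ?s = "\<lambda>n. if k = n then x else \<one>"
  have "\<forall>n\<ge>Suc k. ?s n \<in> U j"
    using subgroup.one_closed[OF subgroup_U] by auto
  then have "cong_mod V (U j) (group_sum V ?s) (finprod V ?s {..<Suc k})"
    by (rule group_sum_cong_U[OF bullet_delta[OF assms]])
  moreover have "finprod V ?s {..<Suc k} = x"
    using assms finprod_singleton[of k "{..<Suc k}" "\<lambda>_. x"] by simp
  ultimately show "cong_mod V (U j) (group_sum V ?s) x"
    by simp
qed

lemma abelian_group_bullet: "abelian_group (bullet V)"
proof (rule abelian_groupI)
  fix s t assume st: "s \<in> carrier (bullet V)" "t \<in> carrier (bullet V)"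
  show "s \<oplus>\<^bsub>bullet V\<^esub> t \<in> carrier (bullet V)"
    using bullet_mult[OF st] by (simp add: bullet_def)
  show "s \<oplus>\<^bsub>bullet V\<^esub> t = t \<oplus>\<^bsub>bullet V\<^esub> s"
    using st[THEN bullet_closed] by (simp add: bullet_def m_comm)
next
  fix r s t assume "r \<in> carrier (bullet V)" "s \<in> carrier (bullet V)" "t \<in> carrier (bullet V)"
  then show "r \<oplus>\<^bsub>bullet V\<^esub> s \<oplus>\<^bsub>bullet V\<^esub> t = r \<oplus>\<^bsub>bullet V\<^esub> (s \<oplus>\<^bsub>bullet V\<^esub> t)"
    by (auto simp: bullet_def m_assoc image_subset_iff)
next
  show "\<zero>\<^bsub>bullet V\<^esub> \<in> carrier (bullet V)"
    using bullet_one by (simp add: bullet_def)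
next
  fix s assume s: "s \<in> carrier (bullet V)"
  then show "\<zero>\<^bsub>bullet V\<^esub> \<oplus>\<^bsub>bullet V\<^esub> s = s"
    by (simp add: bullet_def image_subset_iff)
  show "\<exists>t\<in>carrier (bullet V). t \<oplus>\<^bsub>bullet V\<^esub> s = \<zero>\<^bsub>bullet V\<^esub>"
    using bullet_inv[OF s] s by (intro bexI[of _ "\<lambda>n. inv (s n)"]) (simp_all add: bullet_def image_subset_iff)
qed

lemma left_module_bullet: "left_module \<M> (bullet V)"
proof (intro left_module.intro left_module_axioms.intro)
  show "ring \<M>"
    by (rule ring_colfin)
  show "abelian_group (bullet V)"
    by (rule abelian_group_bullet)
  have add: "(s \<oplus>\<^bsub>bullet V\<^esub> t) n = s n \<otimes> t n" for s t n
    by (simp add: bullet_def)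
  fix c d s t
  assume s: "s \<in> carrier (bullet V)"
  show "\<one>\<^bsub>\<M>\<^esub> \<odot>\<^bsub>bullet V\<^esub> s = s"
  proof
    fix k
    have "(\<lambda>n. s n [^] \<one>\<^bsub>\<M>\<^esub> k n) = (\<lambda>n. if k = n then s k else \<one>)"
      using s by (auto simp: colfin_matrix_ring_def bullet_closed)
    then show "(\<one>\<^bsub>\<M>\<^esub> \<odot>\<^bsub>bullet V\<^esub> s) k = s k"
      using s by (simp add: smult_bullet group_sum_delta bullet_closed)
  qed
  assume c: "c \<in> carrier \<M>"
  show "c \<odot>\<^bsub>bullet V\<^esub> s \<in> carrier (bullet V)"
    using c s by (rule smult_bullet_closed)
  show "c \<odot>\<^bsub>bullet V\<^esub> (s \<oplus>\<^bsub>bullet V\<^esub> t) = c \<odot>\<^bsub>bullet V\<^esub> s \<oplus>\<^bsub>bullet V\<^esub> c \<odot>\<^bsub>bullet V\<^esub> t"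
    if "t \<in> carrier (bullet V)"
    using s that
    by (simp add: fun_eq_iff smult_bullet add int_pow_distrib bullet_closed group_sum_mult bullet_int_pow)
  assume d: "d \<in> carrier \<M>"
  show "(c \<oplus>\<^bsub>\<M>\<^esub> d) \<odot>\<^bsub>bullet V\<^esub> s = c \<odot>\<^bsub>bullet V\<^esub> s \<oplus>\<^bsub>bullet V\<^esub> d \<odot>\<^bsub>bullet V\<^esub> s"
    using s
    by (simp add: fun_eq_iff smult_bullet add colfin_matrix_ring_def int_pow_mult bullet_closed
        group_sum_mult bullet_int_pow)
  show "(c \<otimes>\<^bsub>\<M>\<^esub> d) \<odot>\<^bsub>bullet V\<^esub> s = c \<odot>\<^bsub>bullet V\<^esub> (d \<odot>\<^bsub>bullet V\<^esub> s)"
    using c d s by (rule smult_bullet_assoc)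
qed

end

section \<open>Full faithfulness\<close>

locale filtered_group_pair =
  V: complete_filtered_group V U + V': complete_filtered_group V' U'
  for V :: "'a topgroup" and U and V' :: "'b topgroup" and U'
begin

text \<open>Translation reduces continuity of a homomorphism to the neutral element, where the
  \<open>U j\<close> and the \<open>U' k\<close> form neighbourhood bases.\<close>

lemma continuous_hom_iff:
  assumes f: "f \<in> hom V V'"
  shows "continuous_map (topol V) (topol V') f \<longleftrightarrow> (\<forall>k. \<exists>j. f ` U j \<subseteq> U' k)"
proof -
  interpret f: group_hom V V' f
    using f by unfold_locales
  show ?thesis
  proof
    assume cont: "continuous_map (topol V) (topol V') f"
    show "\<forall>k. \<exists>j. f ` U j \<subseteq> U' k"
    proof
      fix k
      have "openin (topol V') (U' k)"
        using V'.openin_subgroup_iff V'.subgroup_U by blast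
      from openin_continuous_map_preimage[OF cont this]
      have "openin (topol V) {x \<in> carrier V. f x \<in> U' k}"
        by simp
      moreover have "\<one>\<^bsub>V\<^esub> \<in> {x \<in> carrier V. f x \<in> U' k}"
        by (simp add: subgroup.one_closed V'.subgroup_U)
      ultimately obtain j where
        "\<forall>y. cong_mod V (U j) y \<one>\<^bsub>V\<^esub> \<longrightarrow> y \<in> {x \<in> carrier V. f x \<in> U' k}"
        unfolding V.openin_iff by blast
      then show "\<exists>j. f ` U j \<subseteq> U' k"
        using V.U_one_iff by (intro exI[of _ j]) blast
    qed
  next
    assume *: "\<forall>k. \<exists>j. f ` U j \<subseteq> U' k"
    show "continuous_map (topol V) (topol V') f"
      unfolding continuous_map_def
    proof (intro conjI allI impI)
      show "f \<in> topspace (topol V) \<rightarrow> topspace (topol V')"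
        by simp
      fix S assume S: "openin (topol V') S"
      show "openin (topol V) {x \<in> topspace (topol V). f x \<in> S}"
        unfolding V.openin_iff
      proof (intro conjI ballI)
        fix x assume "x \<in> {x \<in> topspace (topol V). f x \<in> S}"
        then have x: "x \<in> carrier V" "f x \<in> S"
          by auto
        then obtain k where k: "\<And>y. cong_mod V' (U' k) y (f x) \<Longrightarrow> y \<in> S"
          using S unfolding V'.openin_iff by blast
        obtain j where "f ` U j \<subseteq> U' k"
          using * by blast
        then have "cong_mod V' (U' k) (f y) (f x)" if "cong_mod V (U j) y x" for y
          using that unfolding cong_mod_def
          by (metis V.inv_closed f.hom_closed f.hom_inv f.hom_mult image_subset_iff)
        then show "\<exists>j. \<forall>y. cong_mod V (U j) y x \<longrightarrow> y \<in> {x \<in> topspace (topol V). f x \<in> S}"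
          using k by (intro exI[of _ j]) (auto dest: cong_mod_carrier)
      qed auto
    qed
  qed
qed

lemma hom_finprod:
  assumes f: "f \<in> hom V V'" and s: "s \<in> A \<rightarrow> carrier V"
  shows "f (finprod V s A) = finprod V' (\<lambda>i. f (s i)) A"
proof -
  interpret f: group_hom V V' f
    using f by unfold_locales
  show ?thesis
    using s by (induction A rule: infinite_finite_induct) (simp_all add: Pi_def)
qed

text \<open>A continuous map preserves the limit of the partial products. Compatibility with
  matrices whose rows are infinite rests on this, as additivity alone handles finite sums.\<close>

lemma hom_group_sum:
  assumes f: "f \<in> hom V V'" and cont: "continuous_map (topol V) (topol V') f"
    and s: "s \<in> carrier (bullet V)"
  shows "f (group_sum V s) = group_sum V' (\<lambda>n. f (s n))"
proof -
  have "limitin (topol V') (f \<circ> (\<lambda>N. finprod V s {..<N})) (f (group_sum V s)) sequentially"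
    using cont V.group_sum_limit[OF s] by (rule continuous_map_limit)
  moreover have "f \<circ> (\<lambda>N. finprod V s {..<N}) = (\<lambda>N. finprod V' (\<lambda>n. f (s n)) {..<N})"
    using s by (auto simp: hom_finprod[OF f] V.bullet_closed)
  ultimately show ?thesis
    using V'.group_sum_eqI by simp
qed

lemma bullet_map_mod_hom:
  assumes "f \<in> cont_hom V V'"
  shows "bullet_map V f \<in> mod_hom \<M> (bullet V) (bullet V')"
proof -
  have f: "f \<in> hom V V'" and cont: "continuous_map (topol V) (topol V') f"
    using assms by (auto simp: cont_hom_def)
  interpret f: group_hom V V' f
    using f by unfold_locales
  have map_closed: "(\<lambda>n. f (s n)) \<in> carrier (bullet V')" if s: "s \<in> carrier (bullet V)" for s
    unfolding V'.carrier_bullet_iff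
  proof (intro conjI allI)
    fix k
    obtain j where "f ` U j \<subseteq> U' k"
      using cont continuous_hom_iff[OF f] by blast
    moreover obtain N where "\<forall>n\<ge>N. s n \<in> U j"
      using s V.carrier_bullet_iff by metis
    ultimately show "\<exists>N. \<forall>n\<ge>N. f (s n) \<in> U' k"
      by blast
  qed (simp add: V.bullet_closed s)
  have "(\<lambda>n. f ((c \<odot>\<^bsub>bullet V\<^esub> s) n)) = c \<odot>\<^bsub>bullet V'\<^esub> (\<lambda>n. f (s n))"
    if s: "s \<in> carrier (bullet V)" for c s
  proof
    fix k
    have "f ((c \<odot>\<^bsub>bullet V\<^esub> s) k) = group_sum V' (\<lambda>n. f (s n [^]\<^bsub>V\<^esub> c k n))"
      using V.bullet_int_pow[OF s] by (simp add: V.smult_bullet hom_group_sum[OF f cont])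
    then show "f ((c \<odot>\<^bsub>bullet V\<^esub> s) k) = (c \<odot>\<^bsub>bullet V'\<^esub> (\<lambda>n. f (s n))) k"
      using s by (simp add: V'.smult_bullet f.hom_int_pow V.bullet_closed)
  qed
  moreover have "(\<lambda>n. f ((s \<oplus>\<^bsub>bullet V\<^esub> t) n)) = (\<lambda>n. f (s n)) \<oplus>\<^bsub>bullet V'\<^esub> (\<lambda>n. f (t n))"
    if "s \<in> carrier (bullet V)" "t \<in> carrier (bullet V)" for s t
    using that[THEN V.bullet_closed] by (simp add: bullet_def)
  moreover have "s \<oplus>\<^bsub>bullet V\<^esub> t \<in> carrier (bullet V)"
    if "s \<in> carrier (bullet V)" "t \<in> carrier (bullet V)" for s t
    using that V.abelian_group_bullet abelian_groupE(1) by metis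
  ultimately show ?thesis
    by (simp add: mod_hom_def bullet_map_def map_closed V.smult_bullet_closed)
qed

text \<open>The sequence with \<open>x\<close> at position \<open>0\<close> and trivial entries
  elsewhere recovers \<open>f x\<close>; extensionality settles the values off the carrier.\<close>

lemma inj_on_bullet_map: "inj_on (bullet_map V) (cont_hom V V')"
proof (rule inj_onI)
  fix f g assume fg: "f \<in> cont_hom V V'" "g \<in> cont_hom V V'" and eq: "bullet_map V f = bullet_map V g"
  show "f = g"
  proof (rule extensionalityI[of _ "carrier V"])
    fix x assume x: "x \<in> carrier V"
    have "(\<lambda>n::nat. f (if 0 = n then x else \<one>\<^bsub>V\<^esub>)) = (\<lambda>n. g (if 0 = n then x else \<one>\<^bsub>V\<^esub>))"
      using fun_cong[OF eq, of "\<lambda>n. if 0 = n then x else \<one>\<^bsub>V\<^esub>"] V.bullet_delta[OF x, of 0]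
      by (simp add: bullet_map_def)
    from fun_cong[OF this, of 0] show "f x = g x"
      by simp
  qed (use fg in \<open>auto simp: cont_hom_def\<close>)
qed

text \<open>A module map commutes with the elementary matrix that moves the entry \<open>k\<close> to the position \<open>0\<close>,
  and is therefore given entrywise by its effect on sequences supported at \<open>0\<close>.\<close>

lemma mod_hom_is_bullet_map:
  assumes \<Phi>: "\<Phi> \<in> mod_hom \<M> (bullet V) (bullet V')"
  shows "\<Phi> \<in> bullet_map V ` cont_hom V V'"
proof -
  have \<Phi>_closed: "\<Phi> s \<in> carrier (bullet V')" if "s \<in> carrier (bullet V)" for s
    using \<Phi> that by (auto simp: mod_hom_def)
  have \<Phi>_smult: "\<Phi> (c \<odot>\<^bsub>bullet V\<^esub> s) = c \<odot>\<^bsub>bullet V'\<^esub> \<Phi> s"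
    if "s \<in> carrier (bullet V)" "c \<in> carrier \<M>" for c s
    using \<Phi> that by (auto simp: mod_hom_def)
  define f where "f = (\<lambda>x\<in>carrier V. \<Phi> (\<lambda>n. if 0 = n then x else \<one>\<^bsub>V\<^esub>) 0)"
  define E :: "nat \<Rightarrow> nat \<Rightarrow> nat \<Rightarrow> int" where
    "E k = (\<lambda>i j. if i = 0 \<and> k = j then 1 else 0)" for k
  have E: "E k \<in> carrier \<M>" for k
    unfolding colfin_carrier_iff by (intro allI exI[of _ 1]) (simp add: E_def)
  have E_smult: "E k \<odot>\<^bsub>bullet V\<^esub> s = (\<lambda>n. if 0 = n then s k else \<one>\<^bsub>V\<^esub>)"
    if s: "s \<in> carrier (bullet V)" for k s
  proof
    fix i
    have "(\<lambda>n. s n [^]\<^bsub>V\<^esub> E k i n) = (\<lambda>n. if k = n then (if 0 = i then s k else \<one>\<^bsub>V\<^esub>) else \<one>\<^bsub>V\<^esub>)"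
      using s by (auto simp: E_def V.bullet_closed)
    moreover have "(if 0 = i then s k else \<one>\<^bsub>V\<^esub>) \<in> carrier V"
      using s by (simp add: V.bullet_closed)
    ultimately show "(E k \<odot>\<^bsub>bullet V\<^esub> s) i = (if 0 = i then s k else \<one>\<^bsub>V\<^esub>)"
      by (simp only: V.smult_bullet V.group_sum_delta)
  qed
  have E_smult_0: "(E k \<odot>\<^bsub>bullet V'\<^esub> t) 0 = t k" if t: "t \<in> carrier (bullet V')" for k t
  proof -
    have "(\<lambda>n. t n [^]\<^bsub>V'\<^esub> E k 0 n) = (\<lambda>n. if k = n then t k else \<one>\<^bsub>V'\<^esub>)"
      using t by (auto simp: E_def V'.bullet_closed)
    then show ?thesis
      using t by (simp add: V'.smult_bullet V'.group_sum_delta V'.bullet_closed)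
  qed
  have \<Phi>_eq: "\<Phi> s k = f (s k)" if s: "s \<in> carrier (bullet V)" for s k
  proof -
    have "\<Phi> s k = (E k \<odot>\<^bsub>bullet V'\<^esub> \<Phi> s) 0"
      using E_smult_0[OF \<Phi>_closed[OF s]] by simp
    also have "\<dots> = \<Phi> (E k \<odot>\<^bsub>bullet V\<^esub> s) 0"
      using \<Phi>_smult[OF s E] by simp
    finally show ?thesis
      using V.bullet_closed[OF s] by (simp add: E_smult[OF s] f_def)
  qed
  have f_hom: "f \<in> hom V V'"
  proof (rule homI)
    fix x assume x: "x \<in> carrier V"
    then show "f x \<in> carrier V'"
      using V'.bullet_closed[OF \<Phi>_closed[OF V.bullet_delta[OF x, of 0]]] by (simp add: f_def)
    fix y assume y: "y \<in> carrier V"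
    let ?x = "\<lambda>n. if 0 = n then x else \<one>\<^bsub>V\<^esub>" and ?y = "\<lambda>n. if 0 = n then y else \<one>\<^bsub>V\<^esub>"
    have "?x \<oplus>\<^bsub>bullet V\<^esub> ?y = (\<lambda>n. if 0 = n then x \<otimes>\<^bsub>V\<^esub> y else \<one>\<^bsub>V\<^esub>)"
      by (auto simp: bullet_def)
    moreover have "\<Phi> (?x \<oplus>\<^bsub>bullet V\<^esub> ?y) = \<Phi> ?x \<oplus>\<^bsub>bullet V'\<^esub> \<Phi> ?y"
      using \<Phi> V.bullet_delta[OF x, of 0] V.bullet_delta[OF y, of 0] by (simp add: mod_hom_def)
    ultimately show "f (x \<otimes>\<^bsub>V\<^esub> y) = f x \<otimes>\<^bsub>V'\<^esub> f y"
      using x y by (simp add: f_def bullet_def)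
  qed
  have "continuous_map (topol V) (topol V') f"
    unfolding continuous_hom_iff[OF f_hom]
  proof (rule ccontr)
    assume "\<not> (\<forall>k. \<exists>j. f ` U j \<subseteq> U' k)"
    then obtain k where "\<forall>j. \<exists>x\<in>U j. f x \<notin> U' k"
      by blast
    \<comment> \<open>The failure of continuity is sampled once at every level. Since the
      \<open>U j\<close> decrease, the \<open>s j\<close> form a null sequence, yet no entry
      \<open>f (s j)\<close> of its image lies in \<open>U' k\<close>.\<close>
    then obtain s where s: "\<And>j. s j \<in> U j" "\<And>j. f (s j) \<notin> U' k"
      by metis
    have s_bullet: "s \<in> carrier (bullet V)"
      unfolding V.carrier_bullet_iff using s(1) V.U_subset V.U_antimono by (meson subsetD)
    then obtain N where "\<forall>n\<ge>N. \<Phi> s n \<in> U' k"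
      using \<Phi>_closed V'.carrier_bullet_iff by metis
    then show False
      using s(2) by (auto simp: \<Phi>_eq[OF s_bullet])
  qed
  then have "f \<in> cont_hom V V'"
    using f_hom by (simp add: cont_hom_def f_def)
  moreover have "\<Phi> = bullet_map V f"
  proof (rule extensionalityI[of _ "carrier (bullet V)"])
    show "\<Phi> \<in> extensional (carrier (bullet V))"
      using \<Phi> by (auto simp: mod_hom_def PiE_def)
  qed (auto simp: bullet_map_def \<Phi>_eq)
  ultimately show ?thesis
    by blast
qed

lemma bij_betw_bullet_map: "bij_betw (bullet_map V) (cont_hom V V') (mod_hom \<M> (bullet V) (bullet V'))"
  unfolding bij_betw_def using inj_on_bullet_map bullet_map_mod_hom mod_hom_is_bullet_map by blast

end

section \<open>Subgroups and quotients\<close>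

text \<open>Congruence in the subgroup is the restriction of congruence in \<open>V\<close>, so the
  axioms restrict; closedness of \<open>W\<close> keeps the limit in \<open>complete\<close> inside
  \<open>W\<close>.\<close>

lemma (in complete_filtered_group) filtered_subspace:
  assumes W: "subgroup W V" and closed: "closedin (topol V) W"
  shows "complete_filtered_group (subspace_group V W) (\<lambda>n. U n \<inter> W)"
proof -
  let ?S = "subspace_group V W"
  have S_simps: "carrier ?S = W" "mult ?S = mult V" "one ?S = one V" "topol ?S = subtopology (topol V) W"
    by (simp_all add: subspace_group_def)
  have W_carrier: "x \<in> carrier V" if "x \<in> W" for x
    using that W subgroup.mem_carrier by metis
  have comm: "comm_group ?S"
  proof (rule comm_groupI)
    fix x assume x: "x \<in> carrier ?S"
    then have "inv x \<otimes> x = \<one>" "inv x \<in> W"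
      using W W_carrier subgroup.m_inv_closed by (auto simp: S_simps)
    then show "\<exists>y\<in>carrier ?S. y \<otimes>\<^bsub>?S\<^esub> x = \<one>\<^bsub>?S\<^esub>"
      unfolding S_simps by blast
  qed (auto simp: S_simps W_carrier m_ac subgroup.one_closed[OF W] subgroup.m_closed[OF W])
  interpret S: comm_group ?S
    by (rule comm)
  have inv_S: "inv\<^bsub>?S\<^esub> x = inv x" if "x \<in> W" for x
    using that W W_carrier subgroup.m_inv_closed by (intro S.inv_equality) (auto simp: S_simps)
  have cong_S: "cong_mod ?S (U n \<inter> W) x y \<longleftrightarrow> x \<in> W \<and> y \<in> W \<and> cong_mod V (U n) x y" for n x y
    using subgroup.m_closed[OF W] subgroup.m_inv_closed[OF W] W_carrier
    by (auto simp: cong_mod_def S_simps inv_S)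
  show ?thesis
  proof (intro complete_filtered_group.intro complete_filtered_group_axioms.intro comm)
    fix n
    show "subgroup (U n \<inter> W) ?S"
      using subgroup.m_closed[OF W] subgroup.m_closed[OF subgroup_U] subgroup.one_closed[OF W]
        subgroup.one_closed[OF subgroup_U] subgroup.m_inv_closed[OF W] subgroup.m_inv_closed[OF subgroup_U]
      by (intro subgroup.intro) (auto simp: S_simps inv_S)
    show "U (Suc n) \<inter> W \<subseteq> U n \<inter> W"
      using U_Suc by blast
  next
    fix T
    show "openin (topol ?S) T \<longleftrightarrow>
        T \<subseteq> carrier ?S \<and> (\<forall>x\<in>T. \<exists>n. \<forall>y. cong_mod ?S (U n \<inter> W) y x \<longrightarrow> y \<in> T)"
      unfolding S_simps cong_S
    proof
      assume "openin (subtopology (topol V) W) T"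
      then obtain G where "openin (topol V) G" "T = G \<inter> W"
        by (auto simp: openin_subtopology)
      then show "T \<subseteq> W \<and> (\<forall>x\<in>T. \<exists>n. \<forall>y. y \<in> W \<and> x \<in> W \<and> cong_mod V (U n) y x \<longrightarrow> y \<in> T)"
        unfolding openin_iff by blast
    next
      assume T: "T \<subseteq> W \<and> (\<forall>x\<in>T. \<exists>n. \<forall>y. y \<in> W \<and> x \<in> W \<and> cong_mod V (U n) y x \<longrightarrow> y \<in> T)"
      then have "\<forall>x\<in>T. \<exists>n. \<forall>y\<in>W. cong_mod V (U n) y x \<longrightarrow> y \<in> T"
        by blast
      then obtain r where r: "\<And>x y. x \<in> T \<Longrightarrow> y \<in> W \<Longrightarrow> cong_mod V (U (r x)) y x \<Longrightarrow> y \<in> T"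
        by metis
      \<comment> \<open>Each point of \<open>T\<close> has its own radius; the union of the
        resulting cosets is open in \<open>V\<close> and meets \<open>W\<close> exactly in
        \<open>T\<close>.\<close>
      let ?G = "\<Union>x\<in>T. {y. cong_mod V (U (r x)) y x}"
      have "openin (topol V) ?G"
        using T W_carrier openin_ball by (intro openin_Union) blast
      moreover have "T = ?G \<inter> W"
      proof
        show "T \<subseteq> ?G \<inter> W"
          using T W_carrier U_refl by blast
      qed (use r in blast)
      ultimately show "openin (subtopology (topol V) W) T"
        by (auto simp: openin_subtopology)
    qed
  next
    fix x assume "\<And>n. x \<in> U n \<inter> W"
    then show "x = \<one>\<^bsub>?S\<^esub>"
      using separated by (simp add: S_simps)
  next
    fix s assume "\<And>n. cong_mod ?S (U n \<inter> W) (s (Suc n)) (s n)"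
    then have s: "\<And>n. cong_mod V (U n) (s (Suc n)) (s n)" "\<And>n. s n \<in> W"
      by (auto simp: cong_S)
    have "\<exists>l. \<forall>n. cong_mod V (U n) (s n) l"
      by (rule complete) (rule s(1))
    then obtain l where "\<forall>n. cong_mod V (U n) (s n) l" ..
    then have l: "\<And>n. cong_mod V (U n) (s n) l" ..
    have "l \<in> W"
    proof (rule ccontr)
      assume "l \<notin> W"
      then have "l \<in> carrier V - W"
        using cong_mod_carrier(2)[OF l] by blast
      moreover have "openin (topol V) (carrier V - W)"
        using closed by (simp add: closedin_def)
      ultimately obtain n where "\<And>y. cong_mod V (U n) y l \<Longrightarrow> y \<in> carrier V - W"
        unfolding openin_iff by blast
      then show False
        using l s(2) by blast
    qed
    then show "\<exists>l. \<forall>n. cong_mod ?S (U n \<inter> W) (s n) l"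
      using l s(2) by (auto simp: cong_S)
  qed
qed

section \<open>The quotient by a closed subgroup\<close>

locale filtered_group_quotient = complete_filtered_group +
  fixes W
  assumes subgroup_W: "subgroup W V" and closed_W: "closedin (topol V) W"
begin

abbreviation Q where "Q \<equiv> quotient_group V W"

lemma quotient_simps:
  "carrier Q = (\<lambda>v. W #> v) ` carrier V" "mult Q = set_mult V" "one Q = W"
  "topol Q = quotient_topology (topol V) (\<lambda>v. W #> v)"
  by (auto simp: quotient_group_def RCOSETS_def)

lemma rcos_mult: "x \<in> carrier V \<Longrightarrow> y \<in> carrier V \<Longrightarrow> (W #> x) <#> (W #> y) = W #> (x \<otimes> y)"
  using normal.rcos_sum subgroup_imp_normal subgroup_W by metis

lemma rcos_eq_iff:
  "x \<in> carrier V \<Longrightarrow> y \<in> carrier V \<Longrightarrow> W #> x = W #> y \<longleftrightarrow> cong_mod V W x y"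
  using cong_mod_rcos_iff subgroup_W by blast

lemma rcos_one: "W #> \<one> = W"
  by (rule coset_mult_one[OF subgroup.subset[OF subgroup_W]])

lemma comm_group_quotient: "comm_group Q"
proof (rule comm_groupI)
  fix X assume "X \<in> carrier Q"
  then obtain x where x: "x \<in> carrier V" "X = W #> x"
    by (auto simp: quotient_simps)
  then show "\<one>\<^bsub>Q\<^esub> \<otimes>\<^bsub>Q\<^esub> X = X"
    using rcos_mult[of \<one> x] by (simp add: quotient_simps rcos_one)
  have "(W #> inv x) \<otimes>\<^bsub>Q\<^esub> X = \<one>\<^bsub>Q\<^esub>"
    using x rcos_mult[of "inv x" x] by (simp add: quotient_simps rcos_one)
  then show "\<exists>Y\<in>carrier Q. Y \<otimes>\<^bsub>Q\<^esub> X = \<one>\<^bsub>Q\<^esub>"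
    using x by (intro bexI[of _ "W #> inv x"]) (simp_all add: quotient_simps)
next
  show "\<one>\<^bsub>Q\<^esub> \<in> carrier Q"
    using rcos_one by (auto simp: quotient_simps intro!: image_eqI[of _ _ \<one>])
next
  fix X Y assume XY: "X \<in> carrier Q" "Y \<in> carrier Q"
  then show "X \<otimes>\<^bsub>Q\<^esub> Y \<in> carrier Q"
    by (auto simp: quotient_simps rcos_mult)
  show "X \<otimes>\<^bsub>Q\<^esub> Y = Y \<otimes>\<^bsub>Q\<^esub> X"
    using XY by (auto simp: quotient_simps rcos_mult m_comm)
  fix Z assume "Z \<in> carrier Q"
  then show "X \<otimes>\<^bsub>Q\<^esub> Y \<otimes>\<^bsub>Q\<^esub> Z = X \<otimes>\<^bsub>Q\<^esub> (Y \<otimes>\<^bsub>Q\<^esub> Z)"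
    using XY by (auto simp: quotient_simps rcos_mult m_assoc)
qed

sublocale Q: comm_group Q
  by (rule comm_group_quotient)

lemma rcos_hom: "(\<lambda>v. W #> v) \<in> hom V Q"
  by (rule homI) (auto simp: quotient_simps rcos_mult)

sublocale q: group_hom V Q "\<lambda>v. W #> v"
  by unfold_locales (rule rcos_hom)

text \<open>This is the subgroup \<open>(W <#> U n)/W\<close>, written as a set of cosets; neither
  of \<open>W\<close> and \<open>U n\<close> need contain the other.\<close>

abbreviation QU where "QU n \<equiv> (\<lambda>v. W #> v) ` U n"

lemma quotient_carrierE:
  assumes "X \<in> carrier Q"
  obtains x where "x \<in> carrier V" "X = W #> x"
  using assms by (auto simp: quotient_simps)

lemma cong_quotient:
  assumes "cong_mod V (U n) x y"
  shows "cong_mod Q (QU n) (W #> x) (W #> y)"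
proof -
  have xy: "x \<in> carrier V" "y \<in> carrier V" "x \<otimes> inv y \<in> U n"
    using assms by (auto simp: cong_mod_def)
  then have "(W #> x) \<otimes>\<^bsub>Q\<^esub> inv\<^bsub>Q\<^esub> (W #> y) = W #> (x \<otimes> inv y)"
    using q.hom_mult[of x "inv y"] q.hom_inv[of y] by simp
  also have "\<dots> \<in> QU n"
    using xy(3) by (rule imageI)
  finally show ?thesis
    unfolding cong_mod_def using xy q.hom_closed by blast
qed

text \<open>The representative is close to the given \<open>y\<close>, not just to some element of
  its coset: if \<open>X\<close> differs from \<open>W #> y\<close> by the image of
  \<open>u \<in> U n\<close>, then \<open>u \<otimes> y\<close> serves. This lifts neighbourhoods
  and Cauchy sequences to \<open>V\<close>.\<close>

lemma cong_quotient_lift: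
  assumes "cong_mod Q (QU n) X (W #> y)" and y: "y \<in> carrier V"
  obtains x where "cong_mod V (U n) x y" "W #> x = X"
proof -
  have X: "X \<in> carrier Q" and "X \<otimes>\<^bsub>Q\<^esub> inv\<^bsub>Q\<^esub> (W #> y) \<in> QU n"
    using assms by (auto simp: cong_mod_def)
  then obtain u where u: "u \<in> U n" "u \<in> carrier V" "X \<otimes>\<^bsub>Q\<^esub> inv\<^bsub>Q\<^esub> (W #> y) = W #> u"
    using U_subset by blast
  have "W #> (u \<otimes> y) = X \<otimes>\<^bsub>Q\<^esub> inv\<^bsub>Q\<^esub> (W #> y) \<otimes>\<^bsub>Q\<^esub> (W #> y)"
    using u y q.hom_mult by simp
  also have "\<dots> = X"
    using X y q.hom_closed by (simp add: Q.m_assoc)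
  finally have "W #> (u \<otimes> y) = X" .
  moreover have "cong_mod V (U n) (u \<otimes> y) y"
    using u y by (simp add: cong_mod_def m_assoc)
  ultimately show thesis
    using that by blast
qed

text \<open>If \<open>x\<close> and \<open>u \<in> U n\<close> have the same coset, then
  \<open>x \<otimes> inv u\<close> is an element of \<open>W\<close> congruent to \<open>x\<close>
  modulo \<open>U n\<close>. Elements of \<open>W\<close> thus come arbitrarily close to
  \<open>x\<close>, and \<open>W\<close> is closed. This gives separation of the quotient.\<close>

lemma mem_W_if_approx:
  assumes x: "x \<in> carrier V" and approx: "\<And>n. W #> x \<in> QU n"
  shows "x \<in> W"
proof (rule ccontr)
  assume "x \<notin> W"
  moreover have "openin (topol V) (carrier V - W)"
    using closed_W by (simp add: closedin_def)
  ultimately obtain n where n: "\<And>y. cong_mod V (U n) y x \<Longrightarrow> y \<in> carrier V - W"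
    using x unfolding openin_iff by blast
  obtain u where u: "u \<in> U n" "W #> x = W #> u" "u \<in> carrier V"
    using approx[of n] U_subset by blast
  then have "x \<otimes> inv u \<in> W"
    using x rcos_eq_iff by (auto simp: cong_mod_def)
  moreover have "cong_mod V (U n) (x \<otimes> inv u) x"
  proof -
    have "x \<otimes> inv u \<otimes> inv x = inv u"
      using x u by (simp add: m_comm[of x "inv u"] m_assoc)
    then show ?thesis
      using x u subgroup.m_inv_closed[OF subgroup_U] by (simp add: cong_mod_def)
  qed
  ultimately show False
    using n by blast
qed

text \<open>The projection maps a coset of \<open>U n\<close> onto a coset of \<open>QU n\<close>:
  \<open>cong_quotient\<close> is one inclusion, \<open>cong_quotient_lift\<close> the
  other.\<close>

lemma openin_quotient_iff:
  "openin (topol Q) S \<longleftrightarrow> S \<subseteq> carrier Q \<and> (\<forall>X\<in>S. \<exists>n. \<forall>Y. cong_mod Q (QU n) Y X \<longrightarrow> Y \<in> S)"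
proof
  assume "openin (topol Q) S"
  then have S: "S \<subseteq> carrier Q" "openin (topol V) {x \<in> carrier V. W #> x \<in> S}"
    by (auto simp: quotient_simps openin_quotient_topology)
  moreover have "\<exists>n. \<forall>Y. cong_mod Q (QU n) Y X \<longrightarrow> Y \<in> S" if X: "X \<in> S" for X
  proof -
    obtain x where x: "x \<in> carrier V" "X = W #> x"
      by (rule quotient_carrierE[OF subsetD[OF S(1) X]])
    then have "x \<in> {x \<in> carrier V. W #> x \<in> S}"
      using X by simp
    then obtain n where n: "\<And>y. cong_mod V (U n) y x \<Longrightarrow> W #> y \<in> S"
      using S(2) unfolding openin_iff by blast
    have "Y \<in> S" if Y: "cong_mod Q (QU n) Y X" for Y
    proof -
      obtain y where "cong_mod V (U n) y x" "W #> y = Y"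
        by (rule cong_quotient_lift[OF Y[unfolded x(2)] x(1)])
      then show ?thesis
        using n by blast
    qed
    then show ?thesis
      by blast
  qed
  ultimately show "S \<subseteq> carrier Q \<and> (\<forall>X\<in>S. \<exists>n. \<forall>Y. cong_mod Q (QU n) Y X \<longrightarrow> Y \<in> S)"
    by blast
next
  assume S: "S \<subseteq> carrier Q \<and> (\<forall>X\<in>S. \<exists>n. \<forall>Y. cong_mod Q (QU n) Y X \<longrightarrow> Y \<in> S)"
  have "openin (topol V) {x \<in> carrier V. W #> x \<in> S}"
    unfolding openin_iff
  proof (intro conjI ballI)
    fix x assume "x \<in> {x \<in> carrier V. W #> x \<in> S}"
    then obtain n where n: "\<And>Y. cong_mod Q (QU n) Y (W #> x) \<Longrightarrow> Y \<in> S"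
      using S by blast
    have "y \<in> {x \<in> carrier V. W #> x \<in> S}" if "cong_mod V (U n) y x" for y
      using n[OF cong_quotient[OF that]] cong_mod_carrier(1)[OF that] by simp
    then show "\<exists>n. \<forall>y. cong_mod V (U n) y x \<longrightarrow> y \<in> {x \<in> carrier V. W #> x \<in> S}"
      by blast
  qed auto
  then show "openin (topol Q) S"
    using S by (auto simp: quotient_simps openin_quotient_topology)
qed

lemma filtered_quotient: "complete_filtered_group Q QU"
proof (intro complete_filtered_group.intro complete_filtered_group_axioms.intro comm_group_quotient)
  fix n
  show "subgroup (QU n) Q"
    using subgroup_U by (rule q.subgroup_img_is_subgroup)
  show "QU (Suc n) \<subseteq> QU n"
    using U_Suc by blast
next
  fix S
  show "openin (topol Q) S \<longleftrightarrow>
      S \<subseteq> carrier Q \<and> (\<forall>X\<in>S. \<exists>n. \<forall>Y. cong_mod Q (QU n) Y X \<longrightarrow> Y \<in> S)"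
    by (rule openin_quotient_iff)
next
  fix X assume X: "\<And>n. X \<in> QU n"
  then obtain x where x: "x \<in> carrier V" "X = W #> x"
    using U_subset by blast
  have "x \<in> W"
    using x X by (intro mem_W_if_approx) auto
  then show "X = \<one>\<^bsub>Q\<^esub>"
    using x coset_join2 subgroup_W by (simp add: quotient_simps)
next
  fix S assume S: "\<And>n. cong_mod Q (QU n) (S (Suc n)) (S n)"
  \<comment> \<open>Each lift is chosen relative to the previous one, so that the lifts satisfy in
    \<open>V\<close> the congruences demanded by \<open>complete\<close>; independent lifts could
    differ by arbitrary elements of \<open>W\<close>.\<close>
  have "\<exists>s. \<forall>n. (s n \<in> carrier V \<and> W #> s n = S n) \<and> cong_mod V (U n) (s (Suc n)) (s n)"
  proof (rule dependent_nat_choice)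
    show "\<exists>x. x \<in> carrier V \<and> W #> x = S 0"
      using cong_mod_carrier(2)[OF S[of 0]] by (auto simp: quotient_simps)
  next
    fix x n assume x: "x \<in> carrier V \<and> W #> x = S n"
    then have "cong_mod Q (QU n) (S (Suc n)) (W #> x)"
      using S[of n] by simp
    then obtain y where y: "cong_mod V (U n) y x" "W #> y = S (Suc n)"
      using x by (elim cong_quotient_lift) simp_all
    then show "\<exists>y. (y \<in> carrier V \<and> W #> y = S (Suc n)) \<and> cong_mod V (U n) y x"
      using cong_mod_carrier(1)[OF y(1)] by blast
  qed
  then obtain s where s: "\<And>n. W #> s n = S n" "\<And>n. cong_mod V (U n) (s (Suc n)) (s n)"
    by blast
  have "\<exists>l. \<forall>n. cong_mod V (U n) (s n) l"
    by (rule complete) (rule s(2))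
  then obtain l where "\<forall>n. cong_mod V (U n) (s n) l" ..
  then have "cong_mod Q (QU n) (S n) (W #> l)" for n
    using cong_quotient[of n "s n" l] by (simp add: s(1))
  then show "\<exists>L. \<forall>n. cong_mod Q (QU n) (S n) L"
    by blast
qed

text \<open>Provides surjectivity on null sequences, the delicate point in preserving quotients:
  arbitrary representatives of a null sequence of cosets need not tend to the neutral
  element.\<close>

lemma null_sequence_lift:
  assumes Z: "Z \<in> carrier (bullet Q)"
  obtains s where "s \<in> carrier (bullet V)" "\<And>n. W #> s n = Z n"
proof -
  interpret C: complete_filtered_group Q QU
    by (rule filtered_quotient)
  \<comment> \<open>each \<open>Z n\<close> is lifted into \<open>U k\<close> with \<open>k \<le> n\<close> as large as possible\<close>
  have "\<exists>x. x \<in> carrier V \<and> W #> x = Z n \<and> (\<forall>k\<le>n. Z n \<in> QU k \<longrightarrow> x \<in> U k)" for n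
  proof (cases "\<exists>k\<le>n. Z n \<in> QU k")
    case True
    let ?P = "\<lambda>k. k \<le> n \<and> Z n \<in> QU k"
    \<comment> \<open>The bound \<open>k \<le> n\<close> makes the maximum exist even when
      \<open>Z n\<close> is trivial and so lies in every \<open>QU k\<close>.\<close>
    define m where "m = Greatest ?P"
    have m: "m \<le> n \<and> Z n \<in> QU m"
      unfolding m_def by (rule GreatestI_ex_nat[of ?P n]) (use True in auto)
    have m_max: "k \<le> m" if "k \<le> n" "Z n \<in> QU k" for k
      unfolding m_def by (rule Greatest_le_nat[of ?P k n]) (use that in auto)
    obtain u where "u \<in> U m" "W #> u = Z n"
      using m by blast
    moreover have "u \<in> U k" if "k \<le> n" "Z n \<in> QU k" for k
      using \<open>u \<in> U m\<close> U_antimono[OF m_max[OF that]] by blast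
    ultimately show ?thesis
      using U_subset by blast
  next
    case False
    moreover obtain x where "x \<in> carrier V" "Z n = W #> x"
      using C.bullet_closed[OF Z] by (rule quotient_carrierE)
    ultimately show ?thesis
      by blast
  qed
  then have "\<exists>s. \<forall>n. s n \<in> carrier V \<and> W #> s n = Z n \<and> (\<forall>k\<le>n. Z n \<in> QU k \<longrightarrow> s n \<in> U k)"
    by (intro choice allI)
  then obtain s where
    "\<forall>n. s n \<in> carrier V \<and> W #> s n = Z n \<and> (\<forall>k\<le>n. Z n \<in> QU k \<longrightarrow> s n \<in> U k)" ..
  then have s: "\<And>n. s n \<in> carrier V" "\<And>n. W #> s n = Z n"
      "\<And>n k. k \<le> n \<Longrightarrow> Z n \<in> QU k \<Longrightarrow> s n \<in> U k"
    by simp_all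
  have "s \<in> carrier (bullet V)"
    unfolding carrier_bullet_iff
  proof (intro conjI allI s(1))
    fix k
    obtain N where "\<forall>n\<ge>N. Z n \<in> QU k"
      using Z C.carrier_bullet_iff by metis
    \<comment> \<open>Depth \<open>k\<close> is guaranteed only from index \<open>k\<close> on,
      hence \<open>max N k\<close>.\<close>
    then show "\<exists>N. \<forall>n\<ge>N. s n \<in> U k"
      using s(3) by (intro exI[of _ "max N k"]) simp
  qed
  then show thesis
    using s(2) by (rule that)
qed

lemma quotient_proj_cont_hom: "quotient_proj V W \<in> cont_hom V Q"
proof -
  have "continuous_map (topol V) (topol Q) (\<lambda>v. W #> v)"
    unfolding quotient_simps(4) by (rule quotient_imp_continuous_map[OF quotient_map_quotient_topology])
  then have "continuous_map (topol V) (topol Q) (quotient_proj V W)"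
    by (rule continuous_map_eq) (simp add: quotient_proj_def)
  moreover have "quotient_proj V W \<in> hom V Q"
    using rcos_hom by (auto simp: quotient_proj_def hom_def)
  ultimately show ?thesis
    by (simp add: cont_hom_def quotient_proj_def)
qed

end

section \<open>Quotient modules and the quotient of null sequences\<close>

text \<open>The additive part is the isomorphism theorem for \<open>M A_Mod N\<close>. What remains
  is the scalar action, where the union in \<open>quotient_module\<close> has to collapse to a
  single coset.\<close>

lemma left_module_first_iso:
  assumes M: "left_module R M" and M': "left_module R M'"
    and \<pi>: "\<pi> \<in> mod_hom R M M'" and surj: "\<pi> ` carrier M = carrier M'"
    and N: "N = {x \<in> carrier M. \<pi> x = \<zero>\<^bsub>M'\<^esub>}"
  obtains \<phi> where "\<phi> \<in> mod_iso R (quotient_module M N) M'"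
    and "\<And>x. x \<in> carrier M \<Longrightarrow> \<phi> (N +>\<^bsub>M\<^esub> x) = \<pi> x"
proof -
  interpret M: left_module R M by (rule M)
  interpret M': left_module R M' by (rule M')
  have \<pi>_closed: "\<pi> x \<in> carrier M'" if "x \<in> carrier M" for x
    using \<pi> that by (auto simp: mod_hom_def)
  have \<pi>_add: "\<pi> (x \<oplus>\<^bsub>M\<^esub> y) = \<pi> x \<oplus>\<^bsub>M'\<^esub> \<pi> y" if "x \<in> carrier M" "y \<in> carrier M" for x y
    using \<pi> that by (simp add: mod_hom_def)
  have \<pi>_smult: "\<pi> (r \<odot>\<^bsub>M\<^esub> x) = r \<odot>\<^bsub>M'\<^esub> \<pi> x" if "r \<in> carrier R" "x \<in> carrier M" for r x
    using \<pi> that by (simp add: mod_hom_def)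
  have ab: "abelian_group_hom M M' \<pi>"
    by (rule abelian_group_homI[OF M.abelian_group_axioms M'.abelian_group_axioms])
      (rule group_hom.intro[OF M.a_group M'.a_group], simp add: group_hom_axioms_def hom_def \<pi>_closed \<pi>_add)
  have kernel: "a_kernel M M' \<pi> = N"
    by (simp add: N a_kernel_def')
  \<comment> \<open>On a coset of the kernel \<open>\<pi>\<close> is constant, so its image is a
    singleton and \<open>the_elem\<close> gives the induced map.\<close>
  let ?\<psi> = "\<lambda>X. the_elem (\<pi> ` X)"
  have "?\<psi> \<in> iso (M A_Mod N) (add_monoid M')"
    using abelian_group_hom.A_FactGroup_iso_set[OF ab surj] by (simp only: kernel)
  then have bij: "bij_betw ?\<psi> (a_rcosets\<^bsub>M\<^esub> N) (carrier M')"
    and \<psi>_add: "\<And>X Y. X \<in> a_rcosets\<^bsub>M\<^esub> N \<Longrightarrow> Y \<in> a_rcosets\<^bsub>M\<^esub> N \<Longrightarrow>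
        ?\<psi> (X <+>\<^bsub>M\<^esub> Y) = ?\<psi> X \<oplus>\<^bsub>M'\<^esub> ?\<psi> Y"
    and \<psi>_closed: "\<And>X. X \<in> a_rcosets\<^bsub>M\<^esub> N \<Longrightarrow> ?\<psi> X \<in> carrier M'"
    by (auto simp: iso_def hom_def A_FactGroup_def')
  have rcosets: "a_rcosets\<^bsub>M\<^esub> N = (\<lambda>x. N +>\<^bsub>M\<^esub> x) ` carrier M"
    by (auto simp: A_RCOSETS_def RCOSETS_def a_r_coset_def)
  have coset_mem: "y \<in> carrier M" "\<pi> y = \<pi> x" if "y \<in> N +>\<^bsub>M\<^esub> x" "x \<in> carrier M" for x y
    using that \<pi>_closed by (auto simp: a_r_coset_def' N \<pi>_add)
  have coset_self: "x \<in> N +>\<^bsub>M\<^esub> x" if "x \<in> carrier M" for x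
  proof -
    have "\<zero>\<^bsub>M\<^esub> \<in> N"
      using abelian_group_hom.hom_zero[OF ab] by (simp add: N)
    then show ?thesis
      using that by (force simp: a_r_coset_def')
  qed
  have \<psi>_coset: "?\<psi> (N +>\<^bsub>M\<^esub> x) = \<pi> x" if x: "x \<in> carrier M" for x
  proof -
    have "\<pi> ` (N +>\<^bsub>M\<^esub> x) = {\<pi> x}"
      using coset_mem(2)[OF _ x] coset_self[OF x] by blast
    then show ?thesis
      by simp
  qed
  have coset_eq: "N +>\<^bsub>M\<^esub> y = N +>\<^bsub>M\<^esub> x" if "x \<in> carrier M" "y \<in> carrier M" "\<pi> y = \<pi> x" for x y
  proof (rule inj_onD[OF bij_betw_imp_inj_on[OF bij]])
    show "?\<psi> (N +>\<^bsub>M\<^esub> y) = ?\<psi> (N +>\<^bsub>M\<^esub> x)"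
      using that by (simp only: \<psi>_coset)
  qed (use that in \<open>simp_all add: rcosets\<close>)
  have smult_coset: "(\<Union>y\<in>N +>\<^bsub>M\<^esub> x. N +>\<^bsub>M\<^esub> (r \<odot>\<^bsub>M\<^esub> y)) = N +>\<^bsub>M\<^esub> (r \<odot>\<^bsub>M\<^esub> x)"
    if r: "r \<in> carrier R" and x: "x \<in> carrier M" for r x
  proof -
    \<comment> \<open>Representatives of one coset have equal images under \<open>\<pi>\<close>,
      hence so do their multiples by \<open>r\<close>; all cosets in the union coincide.\<close>
    have "N +>\<^bsub>M\<^esub> (r \<odot>\<^bsub>M\<^esub> y) = N +>\<^bsub>M\<^esub> (r \<odot>\<^bsub>M\<^esub> x)" if "y \<in> N +>\<^bsub>M\<^esub> x" for y
      using coset_mem[OF that x] r x by (intro coset_eq) (simp_all add: M.smult_closed \<pi>_smult)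
    then show ?thesis
      using coset_self[OF x] by blast
  qed
  \<comment> \<open>Restriction makes the map extensional, as \<open>mod_hom\<close>
    requires.\<close>
  define \<phi> where "\<phi> = restrict ?\<psi> (a_rcosets\<^bsub>M\<^esub> N)"
  have \<phi>_coset: "\<phi> (N +>\<^bsub>M\<^esub> x) = \<pi> x" if "x \<in> carrier M" for x
    using that \<psi>_coset by (simp add: \<phi>_def rcosets)
  have Q_simps: "carrier (quotient_module M N) = a_rcosets\<^bsub>M\<^esub> N" "add (quotient_module M N) = set_add M"
    "\<And>r X. r \<odot>\<^bsub>quotient_module M N\<^esub> X = (\<Union>x\<in>X. N +>\<^bsub>M\<^esub> (r \<odot>\<^bsub>M\<^esub> x))"
    by (simp_all add: quotient_module_def)
  have "\<phi> \<in> mod_hom R (quotient_module M N) M'"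
    unfolding mod_hom_def Q_simps
  proof (intro CollectI conjI ballI)
    show "\<phi> \<in> a_rcosets\<^bsub>M\<^esub> N \<rightarrow>\<^sub>E carrier M'"
      using \<psi>_closed by (simp add: \<phi>_def)
    show "\<phi> (X <+>\<^bsub>M\<^esub> Y) = \<phi> X \<oplus>\<^bsub>M'\<^esub> \<phi> Y" if "X \<in> a_rcosets\<^bsub>M\<^esub> N" "Y \<in> a_rcosets\<^bsub>M\<^esub> N" for X Y
    proof -
      have "X <+>\<^bsub>M\<^esub> Y \<in> a_rcosets\<^bsub>M\<^esub> N"
        using that abelian_subgroup.a_setmult_closed
          abelian_group_hom.abelian_subgroup_a_kernel[OF ab, unfolded kernel] by metis
      then show ?thesis
        using that \<psi>_add by (simp add: \<phi>_def)
    qed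
    show "\<phi> (\<Union>x\<in>X. N +>\<^bsub>M\<^esub> (r \<odot>\<^bsub>M\<^esub> x)) = r \<odot>\<^bsub>M'\<^esub> \<phi> X"
      if r: "r \<in> carrier R" and X: "X \<in> a_rcosets\<^bsub>M\<^esub> N" for r X
    proof -
      obtain x where "x \<in> carrier M" "X = N +>\<^bsub>M\<^esub> x"
        using X by (auto simp: rcosets)
      then show ?thesis
        using r by (simp add: smult_coset \<phi>_coset M.smult_closed \<pi>_smult)
    qed
  qed
  moreover have "bij_betw \<phi> (a_rcosets\<^bsub>M\<^esub> N) (carrier M')"
    using bij by (simp add: \<phi>_def cong: bij_betw_cong)
  ultimately have "\<phi> \<in> mod_iso R (quotient_module M N) M'"
    by (simp add: mod_iso_def Q_simps)
  then show thesis
    using \<phi>_coset by (rule that)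
qed

text \<open>An instance of the isomorphism theorem for the entrywise projection:
  \<open>null_sequence_lift\<close> gives surjectivity, and the kernel consists of the null
  sequences with all entries in \<open>W\<close>.\<close>

lemma (in filtered_group_quotient) quotient_bullet:
  "\<exists>\<phi> \<in> mod_iso \<M> (quotient_module (bullet V) (carrier (bullet (subspace_group V W))))
        (bullet Q).
     \<forall>s \<in> carrier (bullet V).
       \<phi> (carrier (bullet (subspace_group V W)) +>\<^bsub>bullet V\<^esub> s) = bullet_map V (quotient_proj V W) s"
proof -
  interpret C: complete_filtered_group Q QU
    by (rule filtered_quotient)
  interpret pair: filtered_group_pair V U Q QU
    by unfold_locales
  let ?\<pi> = "bullet_map V (quotient_proj V W)"
  have \<pi>_hom: "?\<pi> \<in> mod_hom \<M> (bullet V) (bullet Q)"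
    using quotient_proj_cont_hom by (rule pair.bullet_map_mod_hom)
  have \<pi>: "?\<pi> s = (\<lambda>n. W #> s n)" if "s \<in> carrier (bullet V)" for s
    using that by (simp add: bullet_map_def quotient_proj_def bullet_closed)
  have surj: "?\<pi> ` carrier (bullet V) = carrier (bullet Q)"
  proof
    show "?\<pi> ` carrier (bullet V) \<subseteq> carrier (bullet Q)"
      using \<pi>_hom by (auto simp: mod_hom_def)
    show "carrier (bullet Q) \<subseteq> ?\<pi> ` carrier (bullet V)"
    proof
      fix Z assume "Z \<in> carrier (bullet Q)"
      then obtain s where s: "s \<in> carrier (bullet V)" "\<And>n. W #> s n = Z n"
        using null_sequence_lift by blast
      then have "?\<pi> s = Z"
        using \<pi> by (simp add: fun_eq_iff)
      then show "Z \<in> ?\<pi> ` carrier (bullet V)"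
        using s(1) by blast
    qed
  qed
  have rcos_W: "W #> x = W \<longleftrightarrow> x \<in> W" if "x \<in> carrier V" for x
    using that coset_join1 coset_join2 subgroup_W by blast
  have kernel: "carrier (bullet (subspace_group V W)) =
      {s \<in> carrier (bullet V). ?\<pi> s = \<zero>\<^bsub>bullet Q\<^esub>}" (is "?N = ?K")
  proof -
    \<comment> \<open>Convergence to \<open>\<one>\<close> in the subspace topology agrees with
      convergence in \<open>V\<close> for sequences in \<open>W\<close>, since
      \<open>\<one> \<in> W\<close>.\<close>
    have "s \<in> ?N \<longleftrightarrow> s \<in> carrier (bullet V) \<and> (\<forall>n. s n \<in> W)" for s
      using subgroup.one_closed[OF subgroup_W] subgroup.subset[OF subgroup_W]
      by (auto simp: bullet_def subspace_group_def limitin_subtopology image_subset_iff)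
    moreover have "?\<pi> s = \<zero>\<^bsub>bullet Q\<^esub> \<longleftrightarrow> (\<forall>n. s n \<in> W)" if "s \<in> carrier (bullet V)" for s
    proof -
      have "\<zero>\<^bsub>bullet Q\<^esub> = (\<lambda>n. W)"
        by (simp add: bullet_def quotient_simps)
      then show ?thesis
        using that rcos_W bullet_closed by (simp add: \<pi> fun_eq_iff)
    qed
    ultimately show ?thesis
      by blast
  qed
  show ?thesis
  proof (rule left_module_first_iso[OF left_module_bullet C.left_module_bullet \<pi>_hom surj kernel])
    fix \<phi>
    assume "\<phi> \<in> mod_iso \<M> (quotient_module (bullet V) ?N) (bullet Q)"
      "\<And>s. s \<in> carrier (bullet V) \<Longrightarrow> \<phi> (?N +>\<^bsub>bullet V\<^esub> s) = ?\<pi> s"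
    then show ?thesis
      by (intro bexI[of _ \<phi>] ballI)
  qed
qed

text \<open>The clauses on \<open>left_module\<close> and on \<open>W\<close> and \<open>V/W\<close>
  being complete metrizable record what makes the functor and its quotient statement meaningful; all
  clauses follow once filtrations are chosen.\<close>

theorem proposition5p6:
  shows
    "(\<forall>V :: 'a topgroup. complete_metrizable V \<longrightarrow> left_module \<M> (bullet V)) \<and>
     (\<forall>(V :: 'a topgroup) (V' :: 'b topgroup).
        complete_metrizable V \<and> complete_metrizable V' \<longrightarrow>
        bij_betw (bullet_map V) (cont_hom V V') (mod_hom \<M> (bullet V) (bullet V'))) \<and>
     (\<forall>(V :: 'a topgroup) W.
        complete_metrizable V \<and> subgroup W V \<and> closedin (topol V) W \<longrightarrow>
        complete_metrizable (subspace_group V W) \<and>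
        complete_metrizable (quotient_group V W) \<and>
        (\<exists>\<phi> \<in> mod_iso \<M> (quotient_module (bullet V) (carrier (bullet (subspace_group V W))))
                      (bullet (quotient_group V W)).
           \<forall>s \<in> carrier (bullet V).
             \<phi> (carrier (bullet (subspace_group V W)) +>\<^bsub>bullet V\<^esub> s) =
               bullet_map V (quotient_proj V W) s))"
proof (intro conjI allI impI; (elim conjE)?)
  fix V :: "'a topgroup"
  assume "complete_metrizable V"
  then obtain U where "complete_filtered_group V U"
    by (rule complete_metrizable_imp_filtered)
  then show "left_module \<M> (bullet V)"
    by (rule complete_filtered_group.left_module_bullet)
next
  fix V :: "'a topgroup" and V' :: "'b topgroup"
  assume "complete_metrizable V" "complete_metrizable V'"
  then obtain U U' where "complete_filtered_group V U" "complete_filtered_group V' U'"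
    by (meson complete_metrizable_imp_filtered)
  then show "bij_betw (bullet_map V) (cont_hom V V') (mod_hom \<M> (bullet V) (bullet V'))"
    by (intro filtered_group_pair.bij_betw_bullet_map filtered_group_pair.intro)
next
  fix V :: "'a topgroup" and W
  assume V: "complete_metrizable V" and W: "subgroup W V" "closedin (topol V) W"
  obtain U where U: "complete_filtered_group V U"
    using V by (rule complete_metrizable_imp_filtered)
  then have quotient: "filtered_group_quotient V U W"
    using W by (intro filtered_group_quotient.intro filtered_group_quotient_axioms.intro)
  show "complete_metrizable (subspace_group V W)"
    using complete_filtered_group.filtered_subspace[OF U W]
    by (rule complete_filtered_group.complete_metrizable)
  show "complete_metrizable (quotient_group V W)"
    using filtered_group_quotient.filtered_quotient[OF quotient]
    by (rule complete_filtered_group.complete_metrizable)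
  show "\<exists>\<phi> \<in> mod_iso \<M> (quotient_module (bullet V) (carrier (bullet (subspace_group V W))))
                      (bullet (quotient_group V W)).
           \<forall>s \<in> carrier (bullet V).
             \<phi> (carrier (bullet (subspace_group V W)) +>\<^bsub>bullet V\<^esub> s) =
               bullet_map V (quotient_proj V W) s"
    by (rule filtered_group_quotient.quotient_bullet[OF quotient])
qed

end
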